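(* The Bayesian predictive density with respect to a prior $\pi(\mu,\sigma)$ under the $L^2$ Wasserstein loss is the plug-in density with the posterior mean $(\hat{\mu}^{\pi}(x^n),\hat{\sigma}^{\pi}(x^n))$ of $(\mu,\sigma)$: $$\hat{p}_{\pi}(y\mid x^n)=\frac{1}{\hat{\sigma}^{\pi}(x^n)^d}\,f\!\left(\frac{y-\hat{\mu}^{\pi}(x^n)}{\hat{\sigma}^{\pi}(x^n)}\right),$$ where $$\hat{\mu}^{\pi}(x^n)=\int\mu\,\pi(\mu,\sigma\mid x^n)\,\mathrm{d}\mu\,\mathrm{d}\sigma=\frac{\int\mu\,p(x^n\mid\mu,\sigma)\pi(\mu,\sigma)\,\mathrm{d}\mu\,\mathrm{d}\sigma}{\int p(x^n\mid\mu,\sigma)\pi(\mu,\sigma)\,\mathrm{d}\mu\,\mathrm{d}\sigma},$$ $$\hat{\sigma}^{\pi}(x^n)=\int\sigma\,\pi(\mu,\sigma\mid x^n)\,\mathrm{d}\mu\,\mathrm{d}\sigma=\frac{\int\sigma\,p(x^n\mid\mu,\sigma)\pi(\mu,\sigma)\,\mathrm{d}\mu\,\mathrm{d}\sigma}{\int p(x^n\mid\mu,\sigma)\pi(\mu,\sigma)\,\mathrm{d}\mu\,\mathrm{d}\sigma}.$$ Its risk function is equal to the sum of the (unscaled) quadratic risk functions of $\hat{\mu}^{\pi}(x^n)$ and $\hat{\sigma}^{\pi}(x^n)$, the latter weighted by $d$: $$R((\mu,\sigma),\hat{p}_{\pi})=\mathrm{E}_{\mu,\sigma}\|\hat{\mu}^{\pi}(x^n)-\mu\|^2+d\cdot\mathrm{E}_{\mu,\sigma}(\hat{\sigma}^{\pi}(x^n)-\sigma)^2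 .$$
   Context: Let $f:\mathbb{R}^d\to[0,\infty)$ satisfy $\int f(z)\,\mathrm{d}z=1$, $\int z f(z)\,\mathrm{d}z=0$, $\int zz^\top f(z)\,\mathrm{d}z=I_d$, and let $p(z\mid\mu,\sigma)=\sigma^{-d}f((z-\mu)/\sigma)$, $\mu\in\mathbb{R}^d$, $\sigma>0$, be the associated location-scale family. Independent observations $x^n=(x_1,\ldots,x_n)$, $x_i\sim p(x\mid\mu,\sigma)$, are used to predict an independent $y\sim p(y\mid\mu,\sigma)$, with $(\mu,\sigma)$ unknown; write $p(x^n\mid\mu,\sigma)=\prod_i p(x_i\mid\mu,\sigma)$. A predictive density is a (measurable) family $\hat{p}(\cdot\mid x^n)$ of probability densities on $\mathbb{R}^d$ indexed by $x^n$. For probability distributions $p_1,p_2$ on $\mathbb{R}^d$, $W_2(p_1,p_2)=\inf_{X,Y}\mathrm{E}[\|X-Y\|^2]^{1/2}$, the infimum being over all joint distributions of $(X,Y)$ with marginals $p_1$ and $p_2$. The $L^2$ Wasserstein loss is $W_2(p(\cdot\mid\mu,\sigma),\hat{p}(\cdot\mid x^n))^2$ and the risk is $R((\mu,\sigma),\hat{p})=\int W_2(p(\cdot\mid\mu,\sigma),\hat{p}(\cdot\mid x^n))^2\,p(x^n\mid\mu,\sigma)\,\mathrm{d}x^n\in[0,\infty]$. The Bayesian predictive density $\hat{p}_\pi$ with respect to a prior $\pi(\mu,\sigma)$ is the one minimizing the average risk: $\int R((\mu,\sigma),\hat{p}_\pi)\pi(\mu,\sigma)\,\mathrm{d}\mu\,\mathrm{d}\sigma=\min_{\hat{p}}\int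 R((\mu,\sigma),\hat{p})\pi(\mu,\sigma)\,\mathrm{d}\mu\,\mathrm{d}\sigma$, the minimum being over all predictive densities. $\mathrm{E}_{\mu,\sigma}$ denotes expectation over $x^n\sim p(x^n\mid\mu,\sigma)$, and $\pi(\mu,\sigma\mid x^n)$ is the posterior density. *)

theory Defs
  imports "HOL-Probability.Probability"
begin

section \<open>The Wasserstein distance of order two\<close>

definition ennreal_sqrt :: "ennreal \<Rightarrow> ennreal" where
  "ennreal_sqrt a = (if a = \<top> then \<top> else ennreal (sqrt (enn2real a)))"

definition couplings :: "'a measure \<Rightarrow> 'a measure \<Rightarrow> ('a \<times> 'a) measure set" where
  "couplings P Q = {C. prob_space C \<and> sets C = sets (P \<Otimes>\<^sub>M Q) \<and>
     distr C P fst = P \<and> distr C Q snd = Q}"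

text \<open>The value is \<open>\<infinity>\<close> if no coupling has finite quadratic cost.\<close>

definition W2 :: "'a::euclidean_space measure \<Rightarrow> 'a measure \<Rightarrow> ennreal" where
  "W2 P Q = (INF C\<in>couplings P Q. ennreal_sqrt (\<integral>\<^sup>+(x, y). ennreal ((norm (x - y))\<^sup>2) \<partial>C))"


section \<open>Location-scale families\<close>

text \<open>
  \<^const>\<open>has_bochner_integral\<close> includes integrability, hence also Borel measurability of \<open>f\<close>.
  The last conjunct is the matrix identity \<open>\<integral> z z\<^sup>T f(z) dz = I\<close>.
\<close>

definition standardized_density :: "(real ^ 'd \<Rightarrow> real) \<Rightarrow> bool" where
  "standardized_density f \<longleftrightarrow>
     (\<forall>z. 0 \<le> f z) \<and>
     has_bochner_integral lborel f 1 \<and>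
     has_bochner_integral lborel (\<lambda>z. f z *\<^sub>R z) 0 \<and>
     has_bochner_integral lborel (\<lambda>z. f z *\<^sub>R (\<chi> i j. z $ i * z $ j)) (mat 1 :: real ^ 'd ^ 'd)"

definition loc_scale_density ::
    "(real ^ 'd \<Rightarrow> real) \<Rightarrow> real ^ 'd \<Rightarrow> real \<Rightarrow> real ^ 'd \<Rightarrow> real" where
  "loc_scale_density f \<mu> \<sigma> z = 1 / \<sigma> ^ CARD('d) * f ((z - \<mu>) /\<^sub>R \<sigma>)"

text \<open>A sample \<open>x\<^sub>1, \<dots>, x\<^sub>n\<close> is a function on the index set \<open>{1..n}\<close>.\<close>

definition sample_space :: "nat \<Rightarrow> (nat \<Rightarrow> real ^ 'd) measure" where
  "sample_space n = (\<Pi>\<^sub>M i\<in>{1..n}. lborel)"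

definition likelihood ::
    "(real ^ 'd \<Rightarrow> real) \<Rightarrow> nat \<Rightarrow> real ^ 'd \<Rightarrow> real \<Rightarrow> (nat \<Rightarrow> real ^ 'd) \<Rightarrow> real" where
  "likelihood f n \<mu> \<sigma> x = (\<Prod>i\<in>{1..n}. loc_scale_density f \<mu> \<sigma> (x i))"

definition sample_distr ::
    "(real ^ 'd \<Rightarrow> real) \<Rightarrow> nat \<Rightarrow> real ^ 'd \<Rightarrow> real \<Rightarrow> (nat \<Rightarrow> real ^ 'd) measure" where
  "sample_distr f n \<mu> \<sigma> = density (sample_space n) (\<lambda>x. ennreal (likelihood f n \<mu> \<sigma> x))"


section \<open>Predictive densities and their risk\<close>

definition predictive_density ::
    "nat \<Rightarrow> ((nat \<Rightarrow> real ^ 'd) \<Rightarrow> real ^ 'd \<Rightarrow> real) \<Rightarrow> bool" where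
  "predictive_density n q \<longleftrightarrow>
     (\<lambda>(x, y). q x y) \<in> borel_measurable (sample_space n \<Otimes>\<^sub>M lborel) \<and>
     (\<forall>x\<in>space (sample_space n).
        (\<forall>y. 0 \<le> q x y) \<and> (\<integral>\<^sup>+y. ennreal (q x y) \<partial>lborel) = 1)"

definition risk ::
    "(real ^ 'd \<Rightarrow> real) \<Rightarrow> nat \<Rightarrow> real ^ 'd \<Rightarrow> real \<Rightarrow>
     ((nat \<Rightarrow> real ^ 'd) \<Rightarrow> real ^ 'd \<Rightarrow> real) \<Rightarrow> ennreal" where
  "risk f n \<mu> \<sigma> q =
     (\<integral>\<^sup>+x. (W2 (density lborel (\<lambda>y. ennreal (loc_scale_density f \<mu> \<sigma> y)))
                (density lborel (\<lambda>y. ennreal (q x y))))\<^sup>2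
           * ennreal (likelihood f n \<mu> \<sigma> x) \<partial>sample_space n)"


section \<open>Priors, posteriors and Bayesian predictive densities\<close>

text \<open>Lebesgue measure on the parameters \<open>(\<mu>, \<sigma>)\<close> with \<open>\<sigma> > 0\<close>.\<close>

definition param_measure :: "((real ^ 'd) \<times> real) measure" where
  "param_measure = restrict_space lborel (UNIV \<times> {0<..})"

text \<open>Priors may be improper: the total mass is allowed to be infinite.\<close>

definition prior_density :: "((real ^ 'd) \<times> real \<Rightarrow> real) \<Rightarrow> bool" where
  "prior_density \<pi> \<longleftrightarrow>
     \<pi> \<in> borel_measurable param_measure \<and>
     (\<forall>\<theta>\<in>space param_measure. 0 \<le> \<pi> \<theta>) \<and>
     (\<integral>\<^sup>+\<theta>. ennreal (\<pi> \<theta>) \<partial>param_measure) \<noteq> 0"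

definition average_risk ::
    "(real ^ 'd \<Rightarrow> real) \<Rightarrow> nat \<Rightarrow> ((real ^ 'd) \<times> real \<Rightarrow> real) \<Rightarrow>
     ((nat \<Rightarrow> real ^ 'd) \<Rightarrow> real ^ 'd \<Rightarrow> real) \<Rightarrow> ennreal" where
  "average_risk f n \<pi> q =
     (\<integral>\<^sup>+(\<mu>, \<sigma>). risk f n \<mu> \<sigma> q * ennreal (\<pi> (\<mu>, \<sigma>)) \<partial>param_measure)"

definition bayes_predictive_density ::
    "(real ^ 'd \<Rightarrow> real) \<Rightarrow> nat \<Rightarrow> ((real ^ 'd) \<times> real \<Rightarrow> real) \<Rightarrow>
     ((nat \<Rightarrow> real ^ 'd) \<Rightarrow> real ^ 'd \<Rightarrow> real) \<Rightarrow> bool" where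
  "bayes_predictive_density f n \<pi> q \<longleftrightarrow>
     predictive_density n q \<and>
     (\<forall>q'. predictive_density n q' \<longrightarrow> average_risk f n \<pi> q \<le> average_risk f n \<pi> q')"

definition evidence ::
    "(real ^ 'd \<Rightarrow> real) \<Rightarrow> nat \<Rightarrow> ((real ^ 'd) \<times> real \<Rightarrow> real) \<Rightarrow>
     (nat \<Rightarrow> real ^ 'd) \<Rightarrow> ennreal" where
  "evidence f n \<pi> x =
     (\<integral>\<^sup>+(\<mu>, \<sigma>). ennreal (likelihood f n \<mu> \<sigma> x * \<pi> (\<mu>, \<sigma>)) \<partial>param_measure)"

definition prior_predictive ::
    "(real ^ 'd \<Rightarrow> real) \<Rightarrow> nat \<Rightarrow> ((real ^ 'd) \<times> real \<Rightarrow> real) \<Rightarrow>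
     (nat \<Rightarrow> real ^ 'd) measure" where
  "prior_predictive f n \<pi> = density (sample_space n) (evidence f n \<pi>)"

definition posterior_density ::
    "(real ^ 'd \<Rightarrow> real) \<Rightarrow> nat \<Rightarrow> ((real ^ 'd) \<times> real \<Rightarrow> real) \<Rightarrow>
     (nat \<Rightarrow> real ^ 'd) \<Rightarrow> real ^ 'd \<Rightarrow> real \<Rightarrow> real" where
  "posterior_density f n \<pi> x \<mu> \<sigma> =
     likelihood f n \<mu> \<sigma> x * \<pi> (\<mu>, \<sigma>) /
     (\<integral>(\<mu>', \<sigma>'). likelihood f n \<mu>' \<sigma>' x * \<pi> (\<mu>', \<sigma>') \<partial>param_measure)"

definition posterior_mean_exists ::
    "(real ^ 'd \<Rightarrow> real) \<Rightarrow> nat \<Rightarrow> ((real ^ 'd) \<times> real \<Rightarrow> real) \<Rightarrow>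
     (nat \<Rightarrow> real ^ 'd) \<Rightarrow> bool" where
  "posterior_mean_exists f n \<pi> x \<longleftrightarrow>
     0 < evidence f n \<pi> x \<and> evidence f n \<pi> x < \<infinity> \<and>
     integrable param_measure (\<lambda>(\<mu>, \<sigma>). posterior_density f n \<pi> x \<mu> \<sigma> *\<^sub>R \<mu>) \<and>
     integrable param_measure (\<lambda>(\<mu>, \<sigma>). posterior_density f n \<pi> x \<mu> \<sigma> * \<sigma>)"

text \<open>
  For samples without a posterior mean the estimates are set to \<open>(0, 1)\<close>, so that plugging
  them in always yields a probability density. The choice of this value is immaterial.
\<close>

definition posterior_mean_loc ::
    "(real ^ 'd \<Rightarrow> real) \<Rightarrow> nat \<Rightarrow> ((real ^ 'd) \<times> real \<Rightarrow> real) \<Rightarrow>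
     (nat \<Rightarrow> real ^ 'd) \<Rightarrow> real ^ 'd" where
  "posterior_mean_loc f n \<pi> x =
     (if posterior_mean_exists f n \<pi> x
      then \<integral>(\<mu>, \<sigma>). posterior_density f n \<pi> x \<mu> \<sigma> *\<^sub>R \<mu> \<partial>param_measure else 0)"

definition posterior_mean_scale ::
    "(real ^ 'd \<Rightarrow> real) \<Rightarrow> nat \<Rightarrow> ((real ^ 'd) \<times> real \<Rightarrow> real) \<Rightarrow>
     (nat \<Rightarrow> real ^ 'd) \<Rightarrow> real" where
  "posterior_mean_scale f n \<pi> x =
     (if posterior_mean_exists f n \<pi> x
      then \<integral>(\<mu>, \<sigma>). posterior_density f n \<pi> x \<mu> \<sigma> * \<sigma> \<partial>param_measure else 1)"

definition plug_in_density ::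
    "(real ^ 'd \<Rightarrow> real) \<Rightarrow> nat \<Rightarrow> ((real ^ 'd) \<times> real \<Rightarrow> real) \<Rightarrow>
     (nat \<Rightarrow> real ^ 'd) \<Rightarrow> real ^ 'd \<Rightarrow> real" where
  "plug_in_density f n \<pi> x y =
     loc_scale_density f (posterior_mean_loc f n \<pi> x) (posterior_mean_scale f n \<pi> x) y"

end

(* Let Z have density f and let Y be coupled with mu + sigma Z. For any (mu', sigma') and c = sigma / sigma',
   E|mu + sigma Z - Y|^2 - c E|mu' + sigma' Z - Y|^2 involves only the first two moments of Y, because the
   mixed term in Z and Y cancels. If (mu', sigma') is the posterior mean, then c has posterior mean 1 and the
   posterior mean of this difference is the posterior risk of the plug-in density, independently of Y. Hence a
   predictive density q loses against the plug-in density at least the evidence-weighted integral of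
   (int phi dp' - int phi dq)^2, a lower bound for W2(p', q)^2 for every bounded 1-Lipschitz phi, where p' is
   the plug-in density. Unlike W2 itself, this bound is visibly measurable in the sample, and countably many
   phi determine a distribution, which gives uniqueness. *)

theory Submission
  imports Defs
begin

text \<open>The factor c is forced: the coefficient of the mixed term is -2 \<sigma> + 2 c
  \<sigma>'. Being linear in \<sigma>, c has posterior mean 1 exactly when \<sigma>' is the
  posterior mean of \<sigma>. The subtracted term is kept and not just bounded by zero: \<mu>' +
  \<sigma>' Z has the plug-in law, so together with Y it is a coupling of p' and q, and its cost is
  at least W2(p', q)^2. This surplus is what separates q from the plug-in density. The obstacle is
  finiteness. The prior may be improper, average risks and posterior second moments may be infinite,
  and q may lack a second moment. Hence risks are never subtracted: the central inequality has the
  form (plug-in risk) + (surplus) <= (risk of q) in the extended nonnegative reals. A q without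
  second moment is treated apart, as all its couplings have infinite cost. Cancelling the plug-in
  risk happens once, in the uniqueness proof, where it is known to be finite.\<close>

section \<open>Wasserstein distances in a location-scale family\<close>

lemma ennreal_sqrt_square: "(ennreal_sqrt a)\<^sup>2 = a"
proof (cases a)
  case (real r)
  then show ?thesis by (simp add: ennreal_sqrt_def ennreal_power)
next
  case top
  then show ?thesis by (simp add: ennreal_sqrt_def power2_eq_square ennreal_top_mult)
qed

lemma ennreal_sqrt_mono: "a \<le> b \<Longrightarrow> ennreal_sqrt a \<le> ennreal_sqrt b"
  by (auto simp: ennreal_sqrt_def top_unique enn2real_mono top.not_eq_extremum intro!: ennreal_leI)

text \<open>Monotonicity carries the bound through the root and the infimum, and squaring undoes the
  root; so it suffices to treat each coupling separately.\<close>

lemma W2_square_ge: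
  assumes "\<And>C. C \<in> couplings P Q \<Longrightarrow> b \<le> (\<integral>\<^sup>+(x, y). ennreal ((norm (x - y))\<^sup>2) \<partial>C)"
  shows "b \<le> (W2 P Q)\<^sup>2"
proof -
  have "ennreal_sqrt b \<le> W2 P Q"
    unfolding W2_def by (intro INF_greatest ennreal_sqrt_mono assms)
  then have "(ennreal_sqrt b)\<^sup>2 \<le> (W2 P Q)\<^sup>2"
    by (intro power_mono) auto
  then show ?thesis by (simp add: ennreal_sqrt_square)
qed

lemma W2_square_le:
  assumes "C \<in> couplings P Q"
  shows "(W2 P Q)\<^sup>2 \<le> (\<integral>\<^sup>+(x, y). ennreal ((norm (x - y))\<^sup>2) \<partial>C)"
proof -
  have "W2 P Q \<le> ennreal_sqrt (\<integral>\<^sup>+(x, y). ennreal ((norm (x - y))\<^sup>2) \<partial>C)"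
    unfolding W2_def by (rule INF_lower[OF assms])
  then have "(W2 P Q)\<^sup>2 \<le> (ennreal_sqrt (\<integral>\<^sup>+(x, y). ennreal ((norm (x - y))\<^sup>2) \<partial>C))\<^sup>2"
    by (intro power_mono) auto
  then show ?thesis by (simp add: ennreal_sqrt_square)
qed

section \<open>Moments of the standardized density and the affine change of variables\<close>

context
  fixes f :: "real ^ 'd \<Rightarrow> real"
  assumes f: "standardized_density f"
begin

lemma std_nonneg: "0 \<le> f z" and std_measurable[measurable]: "f \<in> borel_measurable borel"
  using f by (auto simp: standardized_density_def dest!: has_bochner_integral_integrable borel_measurable_integrable)

lemma std_prob_space: "prob_space (density lborel f)"
proof
  have "has_bochner_integral lborel f 1"
    using f by (simp add: standardized_density_def)
  then have "(\<integral>\<^sup>+z. ennreal (f z) \<partial>lborel) = ennreal 1"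
    by (subst nn_integral_eq_integral)
       (auto simp: std_nonneg has_bochner_integral_iff)
  then show "emeasure (density lborel f) (space (density lborel f)) = 1"
    by (simp add: emeasure_density)
qed

lemma std_mean:
  "integrable (density lborel f) (\<lambda>z. z)" "(\<integral>z. z \<partial>density lborel f) = 0"
proof -
  have "has_bochner_integral lborel (\<lambda>z. f z *\<^sub>R z) 0"
    using f by (simp add: standardized_density_def)
  then show "integrable (density lborel f) (\<lambda>z. z)" "(\<integral>z. z \<partial>density lborel f) = 0"
    by (auto simp: has_bochner_integral_iff integrable_density integral_density std_nonneg)
qed

text \<open>The trace of the matrix identity: the trace is bounded linear, hence commutes with the
  integral, and the trace of \<open>mat 1\<close> is the dimension. This is the origin of the factor
  d in the risk formula.\<close>

lemma std_second_moment:
  "integrable (density lborel f) (\<lambda>z. (norm z)\<^sup>2)"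
  "(\<integral>z. (norm z)\<^sup>2 \<partial>density lborel f) = real CARD('d)"
proof -
  have "bounded_linear (\<lambda>A :: real ^ 'd ^ 'd. \<Sum>i\<in>UNIV. A $ i $ i)"
    by (intro bounded_linear_sum bounded_linear_compose[OF bounded_linear_vec_nth] bounded_linear_vec_nth)
  moreover have "has_bochner_integral lborel (\<lambda>z. f z *\<^sub>R (\<chi> i j. z $ i * z $ j)) (mat 1 :: real ^ 'd ^ 'd)"
    using f by (simp add: standardized_density_def)
  ultimately have "has_bochner_integral lborel
      (\<lambda>z. \<Sum>i\<in>UNIV. (f z *\<^sub>R (\<chi> i j. z $ i * z $ j) :: real ^ 'd ^ 'd) $ i $ i)
      (\<Sum>i\<in>UNIV. (mat 1 :: real ^ 'd ^ 'd) $ i $ i)"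
    by (rule has_bochner_integral_bounded_linear)
  moreover have "(\<Sum>i\<in>UNIV. (f z *\<^sub>R (\<chi> i j. z $ i * z $ j) :: real ^ 'd ^ 'd) $ i $ i)
      = f z *\<^sub>R (norm z)\<^sup>2" for z :: "real ^ 'd"
    by (simp add: norm_vec_def L2_set_def sum_nonneg power2_eq_square sum_distrib_left)
  moreover have "(\<Sum>i\<in>UNIV. (mat 1 :: real ^ 'd ^ 'd) $ i $ i) = real CARD('d)"
    by (simp add: mat_def)
  ultimately have "has_bochner_integral lborel (\<lambda>z. f z *\<^sub>R (norm z)\<^sup>2) (real CARD('d))"
    by simp
  then show "integrable (density lborel f) (\<lambda>z. (norm z)\<^sup>2)"
    "(\<integral>z. (norm z)\<^sup>2 \<partial>density lborel f) = real CARD('d)"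
    by (auto simp: has_bochner_integral_iff integrable_density integral_density std_nonneg)
qed

lemma loc_scale_measurable[measurable]: "loc_scale_density f \<mu> \<sigma> \<in> borel_measurable borel"
  unfolding loc_scale_density_def[abs_def] by measurable

lemma loc_scale_nonneg: "0 < \<sigma> \<Longrightarrow> 0 \<le> loc_scale_density f \<mu> \<sigma> y"
  by (simp add: loc_scale_density_def std_nonneg)

text \<open>The Jacobian of the affine map cancels the normalizing power of \<sigma>. From here on a
  member of the family is handled as the law of \<mu> + \<sigma> Z with Z distributed according to
  \<open>f\<close>.\<close>

lemma density_loc_scale:
  assumes "0 < \<sigma>"
  shows "density lborel (loc_scale_density f \<mu> \<sigma>) = distr (density lborel f) borel (\<lambda>z. \<mu> + \<sigma> *\<^sub>R z)"
proof (rule measure_eqI)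
  show "sets (density lborel (loc_scale_density f \<mu> \<sigma>)) = sets (distr (density lborel f) borel (\<lambda>z. \<mu> + \<sigma> *\<^sub>R z))"
    by simp
next
  fix A assume "A \<in> sets (density lborel (loc_scale_density f \<mu> \<sigma>))"
  then have [measurable]: "A \<in> sets borel" by simp
  have eq: "\<sigma> ^ CARD('d) * loc_scale_density f \<mu> \<sigma> (\<mu> + \<sigma> *\<^sub>R z) = f z" for z
    using assms by (simp add: loc_scale_density_def)
  have "emeasure (density lborel (loc_scale_density f \<mu> \<sigma>)) A
      = (\<integral>\<^sup>+y. ennreal (loc_scale_density f \<mu> \<sigma> y) * indicator A y \<partial>lborel)"
    by (simp add: emeasure_density)
  also have "\<dots> = (\<integral>\<^sup>+z. ennreal (\<sigma> ^ CARD('d)) * (ennreal (loc_scale_density f \<mu> \<sigma> (\<mu> + \<sigma> *\<^sub>R z))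
      * indicator A (\<mu> + \<sigma> *\<^sub>R z)) \<partial>lborel)"
    using assms
    by (subst lborel_affine[of \<sigma> \<mu>])
       (simp_all add: nn_integral_density nn_integral_distr)
  also have "\<dots> = (\<integral>\<^sup>+z. ennreal (f z) * indicator ((\<lambda>z. \<mu> + \<sigma> *\<^sub>R z) -` A) z \<partial>lborel)"
    using assms
    by (intro nn_integral_cong)
       (simp add: mult.assoc[symmetric] ennreal_mult[symmetric] loc_scale_nonneg eq[symmetric] indicator_def)
  also have "\<dots> = emeasure (distr (density lborel f) borel (\<lambda>z. \<mu> + \<sigma> *\<^sub>R z)) A"
    by (simp add: emeasure_distr emeasure_density vimage_def)
  finally show "emeasure (density lborel (loc_scale_density f \<mu> \<sigma>)) A
      = emeasure (distr (density lborel f) borel (\<lambda>z. \<mu> + \<sigma> *\<^sub>R z)) A" .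
qed

end

section \<open>Couplings and lower bounds for their cost\<close>

lemma coupling_measurable:
  assumes "C \<in> couplings P Q" "sets P = sets borel" "sets Q = sets borel"
  shows "fst \<in> measurable C borel" "snd \<in> measurable C borel"
proof -
  have "sets C = sets (borel \<Otimes>\<^sub>M borel)"
    using assms sets_pair_measure_cong[OF assms(2,3)] by (simp add: couplings_def)
  then show "fst \<in> measurable C borel" "snd \<in> measurable C borel"
    by (simp_all cong: measurable_cong_sets)
qed

lemma coupling_marginals:
  assumes "C \<in> couplings P Q" "sets P = sets borel" "sets Q = sets borel"
  shows "P = distr C borel fst" "Q = distr C borel snd"
proof -
  have "distr C P fst = distr C borel fst" "distr C Q snd = distr C borel snd"
    using assms by (auto intro!: distr_cong)
  then show "P = distr C borel fst" "Q = distr C borel snd"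
    using assms by (auto simp: couplings_def)
qed

lemma couplings_distr:
  fixes X Y :: "'b \<Rightarrow> 'a::euclidean_space"
  assumes "prob_space M" and [measurable]: "X \<in> borel_measurable M" "Y \<in> borel_measurable M"
  shows "distr M (borel \<Otimes>\<^sub>M borel) (\<lambda>\<omega>. (X \<omega>, Y \<omega>)) \<in> couplings (distr M borel X) (distr M borel Y)"
proof -
  let ?C = "distr M (borel \<Otimes>\<^sub>M borel) (\<lambda>\<omega>. (X \<omega>, Y \<omega>))"
  have "prob_space ?C"
    by (rule prob_space.prob_space_distr[OF assms(1)]) simp
  moreover have "sets ?C = sets (distr M borel X \<Otimes>\<^sub>M distr M borel Y)"
    by (simp cong: sets_pair_measure_cong)
  moreover have "distr ?C (distr M borel X) fst = distr ?C borel fst"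
    by (rule distr_cong) auto
  moreover have "distr ?C (distr M borel Y) snd = distr ?C borel snd"
    by (rule distr_cong) auto
  ultimately show ?thesis
    by (simp add: couplings_def distr_distr comp_def)
qed

text \<open>Nonnegativity of the variance.\<close>

lemma (in prob_space) square_expectation_le:
  fixes U :: "'a \<Rightarrow> real"
  assumes [measurable]: "U \<in> borel_measurable M" and "integrable M (\<lambda>\<omega>. (U \<omega>)\<^sup>2)"
  shows "(expectation U)\<^sup>2 \<le> expectation (\<lambda>\<omega>. (U \<omega>)\<^sup>2)"
proof -
  have "integrable M U"
    using assms by (rule square_integrable_imp_integrable)
  from variance_eq[OF this assms(2)] variance_positive[of U] show ?thesis
    by simp
qed

text \<open>
  With \<open>c = \<sigma> / \<sigma>'\<close>, the difference \<open>|\<mu> + \<sigma> z - y|\<^sup>2 - c |\<mu>' + \<sigma>' z - y|\<^sup>2\<close> contains no mixed term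
  in \<open>z\<close> and \<open>y\<close>, so its expectation depends on a coupling through the marginals only.
\<close>

lemma norm_square_scale_difference:
  fixes \<mu> \<mu>' y z :: "'a::real_inner"
  assumes "\<sigma>' \<noteq> 0"
  shows "(norm (\<mu> + \<sigma> *\<^sub>R z - y))\<^sup>2
    = \<sigma> / \<sigma>' * (norm (\<mu>' + \<sigma>' *\<^sub>R z - y))\<^sup>2
      + ((norm \<mu>)\<^sup>2 - \<sigma> / \<sigma>' * (norm \<mu>')\<^sup>2 - 2 * (y \<bullet> (\<mu> - (\<sigma> / \<sigma>') *\<^sub>R \<mu>'))
         + (1 - \<sigma> / \<sigma>') * (norm y)\<^sup>2 + \<sigma> * (\<sigma> - \<sigma>') * (norm z)\<^sup>2 + 2 * \<sigma> * (z \<bullet> (\<mu> - \<mu>')))"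
  using assms unfolding power2_norm_eq_inner
  by (simp add: inner_simps inner_commute field_simps power2_eq_square)

text \<open>The expectation of the bracket in \<open>norm_square_scale_difference\<close> when z has
  mean 0 and second moment \<open>d\<close>, and y has mean \<open>m\<close> and second moment
  \<open>M\<close>; the term linear in z drops out.\<close>

definition excess_cost ::
    "nat \<Rightarrow> 'a::euclidean_space \<Rightarrow> real \<Rightarrow> 'a \<Rightarrow> real \<Rightarrow> 'a \<Rightarrow> real \<Rightarrow> real" where
  "excess_cost d \<mu> \<sigma> \<mu>' \<sigma>' m M =
     (norm \<mu>)\<^sup>2 - \<sigma> / \<sigma>' * (norm \<mu>')\<^sup>2 - 2 * (m \<bullet> (\<mu> - (\<sigma> / \<sigma>') *\<^sub>R \<mu>'))
       + (1 - \<sigma> / \<sigma>') * M + d * \<sigma> * (\<sigma> - \<sigma>')"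

lemma measurable_excess_cost[measurable (raw)]:
  assumes [measurable]: "\<mu> \<in> borel_measurable N" "\<sigma> \<in> borel_measurable N" "\<mu>' \<in> borel_measurable N"
    "\<sigma>' \<in> borel_measurable N" "m \<in> borel_measurable N" "M \<in> borel_measurable N"
  shows "(\<lambda>x. excess_cost d (\<mu> x) (\<sigma> x) (\<mu>' x) (\<sigma>' x) (m x) (M x)) \<in> borel_measurable N"
  unfolding excess_cost_def by measurable

text \<open>The arguments \<open>m\<close> and \<open>M\<close> are here the moments of the law with
  parameters \<mu>', \<sigma>'. The value turns out to be the squared distance inside the family, so
  the lower bound is sharp there.\<close>

lemma excess_cost_plug_in:
  assumes "\<sigma>' \<noteq> 0"
  shows "excess_cost d \<mu> \<sigma> \<mu>' \<sigma>' \<mu>' ((norm \<mu>')\<^sup>2 + d * \<sigma>'\<^sup>2) = (norm (\<mu>' - \<mu>))\<^sup>2 + d * (\<sigma>' - \<sigma>)\<^sup>2"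
  using assms unfolding excess_cost_def power2_norm_eq_inner
  by (simp add: inner_simps inner_commute field_simps power2_eq_square)

text \<open>By the parallelogram law the defect is |a - b|^2.\<close>

lemma norm_add_square_le:
  fixes a b :: "'a::real_inner"
  shows "(norm (a + b))\<^sup>2 \<le> 2 * (norm a)\<^sup>2 + 2 * (norm b)\<^sup>2"
  using zero_le_power2[of "norm (a - b)"] unfolding power2_norm_eq_inner
  by (simp add: inner_simps inner_commute)

text \<open>The cost of \<open>C\<close> equals \<sigma> / \<sigma>' times the cost of the induced
  coupling of the law with parameters \<mu>', \<sigma>' and \<open>Q\<close>, plus the excess cost.
  The induced cost is bounded below through \<phi>: the squared mean of \<phi>(T) - \<phi>(y) is at
  most its mean square, which is at most the mean of |T - y|^2 by the Lipschitz property.\<close>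

lemma coupling_cost_ge:
  fixes f :: "real ^ 'd \<Rightarrow> real" and \<phi> :: "real ^ 'd \<Rightarrow> real"
  assumes f: "standardized_density f" and \<sigma>: "0 < \<sigma>" and \<sigma>': "0 < \<sigma>'"
    and Q: "sets Q = sets borel" "integrable Q (\<lambda>y. y)" "integrable Q (\<lambda>y. (norm y)\<^sup>2)"
    and \<phi>: "\<And>x y. \<bar>\<phi> x - \<phi> y\<bar> \<le> norm (x - y)" "bounded (range \<phi>)"
    and C: "C \<in> couplings (density lborel (loc_scale_density f \<mu> \<sigma>)) Q"
  shows "ennreal (\<sigma> / \<sigma>' * ((\<integral>y. \<phi> y \<partial>density lborel (loc_scale_density f \<mu>' \<sigma>')) - (\<integral>y. \<phi> y \<partial>Q))\<^sup>2
      + excess_cost CARD('d) \<mu> \<sigma> \<mu>' \<sigma>' (\<integral>y. y \<partial>Q) (\<integral>y. (norm y)\<^sup>2 \<partial>Q))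
    \<le> (\<integral>\<^sup>+(x, y). ennreal ((norm (x - y))\<^sup>2) \<partial>C)"
proof -
  let ?Z = "density lborel f" and ?P = "density lborel (loc_scale_density f \<mu> \<sigma>)"
  \<comment> \<open>Standardizing the first coordinate recovers a variable with density
    \<open>f\<close> on the coupling space. \<open>T\<close> then rescales this same variable, so
    (T, y) couples the comparison law with \<open>Q\<close>.\<close>
  define z where "z = (\<lambda>\<omega>::(real ^ 'd) \<times> (real ^ 'd). (1 / \<sigma>) *\<^sub>R (fst \<omega> - \<mu>))"
  define y where "y = (\<lambda>\<omega>::(real ^ 'd) \<times> (real ^ 'd). snd \<omega>)"
  define T where "T = (\<lambda>\<omega>. \<mu>' + \<sigma>' *\<^sub>R z \<omega>)"
  interpret C: prob_space C using C by (simp add: couplings_def)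
  note [measurable] = coupling_measurable[OF C _ Q(1), simplified]
  have [measurable]: "z \<in> borel_measurable C" "y \<in> borel_measurable C" "T \<in> borel_measurable C"
    by (simp_all add: z_def y_def T_def)
  have "continuous_on UNIV \<phi>"
    using \<phi>(1) by (intro lipschitz_on_continuous_on[of 1] lipschitz_onI) (auto simp: dist_norm)
  then have [measurable]: "\<phi> \<in> borel_measurable borel"
    by (rule borel_measurable_continuous_onI)
  have P: "?P = distr C borel fst" and Qeq: "Q = distr C borel y"
    using coupling_marginals[OF C _ Q(1)] by (simp_all add: y_def)
  have Z: "?Z = distr C borel z"
  proof -
    have "distr C borel z = distr ?P borel (\<lambda>x. (1 / \<sigma>) *\<^sub>R (x - \<mu>))"
      unfolding P by (simp add: distr_distr comp_def z_def)
    also have "\<dots> = distr ?Z borel (\<lambda>z. z)"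
      using \<sigma> by (simp add: density_loc_scale[OF f] distr_distr comp_def)
    also have "\<dots> = ?Z"
      by (rule distr_id2) simp
    finally show ?thesis ..
  qed
  have P': "density lborel (loc_scale_density f \<mu>' \<sigma>') = distr C borel T"
    using \<sigma>' by (simp add: density_loc_scale[OF f] Z distr_distr comp_def T_def)
  have "integrable C z"
    using std_mean(1)[OF f] unfolding Z by (subst (asm) integrable_distr_eq) simp_all
  moreover have "integrable C (\<lambda>\<omega>. (norm (z \<omega>))\<^sup>2)"
    using std_second_moment(1)[OF f] unfolding Z by (subst (asm) integrable_distr_eq) simp_all
  moreover have "integrable C y" "integrable C (\<lambda>\<omega>. (norm (y \<omega>))\<^sup>2)"
    using Q(2,3) unfolding Qeq by (simp_all add: integrable_distr_eq)
  ultimately have [simp]: "integrable C z" "integrable C y"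
    "integrable C (\<lambda>\<omega>. (norm (z \<omega>))\<^sup>2)" "integrable C (\<lambda>\<omega>. (norm (y \<omega>))\<^sup>2)"
    by blast+
  have Ez: "C.expectation z = 0" "C.expectation (\<lambda>\<omega>. (norm (z \<omega>))\<^sup>2) = CARD('d)"
    using std_mean(2)[OF f] std_second_moment(2)[OF f] unfolding Z by (simp_all add: integral_distr)
  have Ey: "C.expectation y = (\<integral>y. y \<partial>Q)" "C.expectation (\<lambda>\<omega>. (norm (y \<omega>))\<^sup>2) = (\<integral>y. (norm y)\<^sup>2 \<partial>Q)"
    unfolding Qeq by (simp_all add: integral_distr)
  \<comment> \<open>The constants 4 and 2 come from applying \<open>norm_add_square_le\<close>
    twice, first to T - y and then to \<mu>' + \<sigma>' z.\<close>
  have int_T: "integrable C (\<lambda>\<omega>. (norm (T \<omega> - y \<omega>))\<^sup>2)"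
  proof (rule Bochner_Integration.integrable_bound)
    show "integrable C (\<lambda>\<omega>. 4 * (norm \<mu>')\<^sup>2 + 4 * (\<sigma>'\<^sup>2 * (norm (z \<omega>))\<^sup>2) + 2 * (norm (y \<omega>))\<^sup>2)"
      by simp
    have "(norm (T \<omega> - y \<omega>))\<^sup>2 \<le> 4 * (norm \<mu>')\<^sup>2 + 4 * (\<sigma>'\<^sup>2 * (norm (z \<omega>))\<^sup>2) + 2 * (norm (y \<omega>))\<^sup>2" for \<omega>
    proof -
      have "(norm (T \<omega> - y \<omega>))\<^sup>2 \<le> 2 * (norm (T \<omega>))\<^sup>2 + 2 * (norm (y \<omega>))\<^sup>2"
        using norm_add_square_le[of "T \<omega>" "- y \<omega>"] by simp
      also have "(norm (T \<omega>))\<^sup>2 \<le> 2 * (norm \<mu>')\<^sup>2 + 2 * (\<sigma>'\<^sup>2 * (norm (z \<omega>))\<^sup>2)"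
        using norm_add_square_le[of \<mu>' "\<sigma>' *\<^sub>R z \<omega>"] by (simp add: T_def power_mult_distrib)
      finally show ?thesis by simp
    qed
    then show "AE \<omega> in C. norm ((norm (T \<omega> - y \<omega>))\<^sup>2)
        \<le> norm (4 * (norm \<mu>')\<^sup>2 + 4 * (\<sigma>'\<^sup>2 * (norm (z \<omega>))\<^sup>2) + 2 * (norm (y \<omega>))\<^sup>2)"
      by (intro AE_I2) (simp add: order_trans[OF _ abs_ge_self])
  qed simp
  obtain B where "\<And>x. norm (\<phi> x) \<le> B"
    using \<phi>(2) by (auto simp: bounded_iff)
  then have "integrable C (\<lambda>\<omega>. \<phi> (T \<omega>))" "integrable C (\<lambda>\<omega>. \<phi> (y \<omega>))"
    by (auto intro!: C.integrable_const_bound[where B = B])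
  then have "((\<integral>y. \<phi> y \<partial>density lborel (loc_scale_density f \<mu>' \<sigma>')) - (\<integral>y. \<phi> y \<partial>Q))\<^sup>2
      = (C.expectation (\<lambda>\<omega>. \<phi> (T \<omega>) - \<phi> (y \<omega>)))\<^sup>2"
    unfolding P' Qeq by (simp add: integral_distr)
  moreover have sq: "(\<phi> (T \<omega>) - \<phi> (y \<omega>))\<^sup>2 \<le> (norm (T \<omega> - y \<omega>))\<^sup>2" for \<omega>
    using \<phi>(1)[of "T \<omega>" "y \<omega>"] by (simp add: abs_le_square_iff[symmetric])
  moreover have int_sq: "integrable C (\<lambda>\<omega>. (\<phi> (T \<omega>) - \<phi> (y \<omega>))\<^sup>2)"
    by (rule Bochner_Integration.integrable_bound[OF int_T]) (use sq in auto)
  moreover have "C.expectation (\<lambda>\<omega>. (\<phi> (T \<omega>) - \<phi> (y \<omega>))\<^sup>2) \<le> C.expectation (\<lambda>\<omega>. (norm (T \<omega> - y \<omega>))\<^sup>2)"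
    by (rule integral_mono[OF int_sq int_T sq])
  ultimately have lower: "((\<integral>y. \<phi> y \<partial>density lborel (loc_scale_density f \<mu>' \<sigma>')) - (\<integral>y. \<phi> y \<partial>Q))\<^sup>2
      \<le> C.expectation (\<lambda>\<omega>. (norm (T \<omega> - y \<omega>))\<^sup>2)"
    using C.square_expectation_le[of "\<lambda>\<omega>. \<phi> (T \<omega>) - \<phi> (y \<omega>)"] by simp
  \<comment> \<open>\<open>D\<close> is the coupling cost in decomposed form. Each summand is
    integrable by the moment assumptions, so the integrability and the expectation of the cost are
    read off from this form.\<close>
  define D where "D = (\<lambda>\<omega>. \<sigma> / \<sigma>' * (norm (T \<omega> - y \<omega>))\<^sup>2
      + ((norm \<mu>)\<^sup>2 - \<sigma> / \<sigma>' * (norm \<mu>')\<^sup>2 - 2 * (y \<omega> \<bullet> (\<mu> - (\<sigma> / \<sigma>') *\<^sub>R \<mu>'))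
         + (1 - \<sigma> / \<sigma>') * (norm (y \<omega>))\<^sup>2 + \<sigma> * (\<sigma> - \<sigma>') * (norm (z \<omega>))\<^sup>2
         + 2 * \<sigma> * (z \<omega> \<bullet> (\<mu> - \<mu>'))))"
  have D_eq: "D \<omega> = (norm (fst \<omega> - snd \<omega>))\<^sup>2" for \<omega>
    using norm_square_scale_difference[of \<sigma>' \<mu> \<sigma> "z \<omega>" "y \<omega>" \<mu>'] \<sigma> \<sigma>'
    by (simp add: D_def T_def z_def y_def)
  have int_D: "integrable C D"
    unfolding D_def using int_T by (intro Bochner_Integration.integrable_add Bochner_Integration.integrable_diff integrable_mult_right) simp_all
  have "C.expectation D = \<sigma> / \<sigma>' * C.expectation (\<lambda>\<omega>. (norm (T \<omega> - y \<omega>))\<^sup>2)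
      + excess_cost CARD('d) \<mu> \<sigma> \<mu>' \<sigma>' (\<integral>y. y \<partial>Q) (\<integral>y. (norm y)\<^sup>2 \<partial>Q)"
    unfolding D_def excess_cost_def
    using int_T by (simp add: Ez Ey C.prob_space)
  then have "\<sigma> / \<sigma>' * ((\<integral>y. \<phi> y \<partial>density lborel (loc_scale_density f \<mu>' \<sigma>')) - (\<integral>y. \<phi> y \<partial>Q))\<^sup>2
      + excess_cost CARD('d) \<mu> \<sigma> \<mu>' \<sigma>' (\<integral>y. y \<partial>Q) (\<integral>y. (norm y)\<^sup>2 \<partial>Q) \<le> C.expectation D"
    using lower \<sigma> \<sigma>' by (simp add: mult_left_mono divide_right_mono)
  then have "ennreal (\<sigma> / \<sigma>' * ((\<integral>y. \<phi> y \<partial>density lborel (loc_scale_density f \<mu>' \<sigma>')) - (\<integral>y. \<phi> y \<partial>Q))\<^sup>2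
      + excess_cost CARD('d) \<mu> \<sigma> \<mu>' \<sigma>' (\<integral>y. y \<partial>Q) (\<integral>y. (norm y)\<^sup>2 \<partial>Q)) \<le> ennreal (C.expectation D)"
    by (rule ennreal_leI)
  also have "\<dots> = (\<integral>\<^sup>+\<omega>. ennreal (D \<omega>) \<partial>C)"
    using int_D by (intro nn_integral_eq_integral[symmetric]) (auto simp: D_eq)
  also have "\<dots> = (\<integral>\<^sup>+(x, y). ennreal ((norm (x - y))\<^sup>2) \<partial>C)"
    by (simp add: D_eq case_prod_beta')
  finally show ?thesis .
qed

text \<open>The first marginal has a finite second moment, and |y|^2 <= 2 |x|^2 + 2 |x - y|^2; an
  infinite second moment of \<open>Q\<close> must therefore be paid for by the cost.\<close>

lemma coupling_cost_infinite:
  fixes f :: "real ^ 'd \<Rightarrow> real"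
  assumes f: "standardized_density f" and \<sigma>: "0 < \<sigma>"
    and Q: "sets Q = sets borel" "(\<integral>\<^sup>+y. ennreal ((norm y)\<^sup>2) \<partial>Q) = \<infinity>"
    and C: "C \<in> couplings (density lborel (loc_scale_density f \<mu> \<sigma>)) Q"
  shows "(\<integral>\<^sup>+(x, y). ennreal ((norm (x - y))\<^sup>2) \<partial>C) = \<infinity>"
proof -
  let ?P = "density lborel (loc_scale_density f \<mu> \<sigma>)"
  interpret Z: prob_space "density lborel f" by (rule std_prob_space[OF f])
  note [measurable] = std_measurable[OF f] loc_scale_measurable[OF f] coupling_measurable[OF C _ Q(1), simplified]
  have P: "?P = distr C borel fst" and Qeq: "Q = distr C borel snd"
    using coupling_marginals[OF C _ Q(1)] by simp_all
  have "integrable (density lborel f) (\<lambda>z. 2 * (norm \<mu>)\<^sup>2 + 2 * (\<sigma>\<^sup>2 * (norm z)\<^sup>2))"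
    using std_second_moment(1)[OF f] by simp
  then have "integrable (density lborel f) (\<lambda>z. (norm (\<mu> + \<sigma> *\<^sub>R z))\<^sup>2)"
    by (rule Bochner_Integration.integrable_bound)
       (use norm_add_square_le[of \<mu> "\<sigma> *\<^sub>R _"] in \<open>auto simp: power_mult_distrib\<close>)
  then have "integrable ?P (\<lambda>x. (norm x)\<^sup>2)"
    using \<sigma> by (simp add: density_loc_scale[OF f] integrable_distr_eq)
  then have "(\<integral>\<^sup>+x. ennreal ((norm x)\<^sup>2) \<partial>?P) < \<infinity>"
    by (subst nn_integral_eq_integral) auto
  then have fin: "(\<integral>\<^sup>+\<omega>. ennreal ((norm (fst \<omega>))\<^sup>2) \<partial>C) < \<infinity>"
    unfolding P by (simp add: nn_integral_distr)
  have "\<infinity> = (\<integral>\<^sup>+\<omega>. ennreal ((norm (snd \<omega>))\<^sup>2) \<partial>C)"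
    using Q(2) unfolding Qeq by (simp add: nn_integral_distr)
  also have "\<dots> \<le> (\<integral>\<^sup>+\<omega>. 2 * ennreal ((norm (fst \<omega>))\<^sup>2) + 2 * ennreal ((norm (fst \<omega> - snd \<omega>))\<^sup>2) \<partial>C)"
  proof (intro nn_integral_mono)
    fix \<omega> :: "(real ^ 'd) \<times> (real ^ 'd)"
    have "ennreal ((norm (snd \<omega>))\<^sup>2) \<le> ennreal (2 * (norm (fst \<omega>))\<^sup>2 + 2 * (norm (fst \<omega> - snd \<omega>))\<^sup>2)"
      using norm_add_square_le[of "fst \<omega>" "snd \<omega> - fst \<omega>"] by (intro ennreal_leI) (simp add: norm_minus_commute)
    then show "ennreal ((norm (snd \<omega>))\<^sup>2)
        \<le> 2 * ennreal ((norm (fst \<omega>))\<^sup>2) + 2 * ennreal ((norm (fst \<omega> - snd \<omega>))\<^sup>2)"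
      by (simp add: ennreal_mult)
  qed
  also have "\<dots> = (\<integral>\<^sup>+\<omega>. 2 * ennreal ((norm (fst \<omega>))\<^sup>2) \<partial>C)
      + (\<integral>\<^sup>+\<omega>. 2 * ennreal ((norm (fst \<omega> - snd \<omega>))\<^sup>2) \<partial>C)"
    by (rule nn_integral_add) simp_all
  also have "\<dots> = 2 * (\<integral>\<^sup>+\<omega>. ennreal ((norm (fst \<omega>))\<^sup>2) \<partial>C)
      + 2 * (\<integral>\<^sup>+\<omega>. ennreal ((norm (fst \<omega> - snd \<omega>))\<^sup>2) \<partial>C)"
    by (simp add: nn_integral_cmult)
  finally show ?thesis
    using fin unfolding case_prod_beta' by (auto simp: top_unique ennreal_mult_eq_top_iff)
qed

section \<open>Closed form of the distance within the family\<close>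

lemma loc_scale_moments:
  fixes f :: "real ^ 'd \<Rightarrow> real" and \<mu> :: "real ^ 'd" and \<sigma> :: real
  assumes f: "standardized_density f" and \<sigma>: "0 < \<sigma>"
  defines "P \<equiv> density lborel (loc_scale_density f \<mu> \<sigma>)"
  shows "integrable P (\<lambda>x. x)" "(\<integral>x. x \<partial>P) = \<mu>"
    "integrable P (\<lambda>x. (norm x)\<^sup>2)" "(\<integral>x. (norm x)\<^sup>2 \<partial>P) = (norm \<mu>)\<^sup>2 + CARD('d) * \<sigma>\<^sup>2"
proof -
  interpret Z: prob_space "density lborel f" by (rule std_prob_space[OF f])
  note [simp] = std_mean[OF f] std_second_moment[OF f] Z.prob_space[simplified]
  have P: "P = distr (density lborel f) borel (\<lambda>z. \<mu> + \<sigma> *\<^sub>R z)"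
    unfolding P_def by (rule density_loc_scale[OF f \<sigma>])
  have sq: "(norm (\<mu> + \<sigma> *\<^sub>R z))\<^sup>2 = (norm \<mu>)\<^sup>2 + 2 * \<sigma> * (z \<bullet> \<mu>) + \<sigma>\<^sup>2 * (norm z)\<^sup>2" for z
    unfolding power2_norm_eq_inner by (simp add: inner_simps inner_commute power2_eq_square)
  show "integrable P (\<lambda>x. x)" "integrable P (\<lambda>x. (norm x)\<^sup>2)"
    unfolding P by (simp_all add: integrable_distr_eq sq)
  show "(\<integral>x. x \<partial>P) = \<mu>" "(\<integral>x. (norm x)\<^sup>2 \<partial>P) = (norm \<mu>)\<^sup>2 + CARD('d) * \<sigma>\<^sup>2"
    unfolding P by (simp_all add: integral_distr sq)
qed

text \<open>The coupling that drives both laws by the same Z attains the value. The matching lower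
  bound is \<open>coupling_cost_ge\<close> with the second law itself as comparison law.\<close>

lemma W2_loc_scale:
  fixes f :: "real ^ 'd \<Rightarrow> real" and \<sigma> \<sigma>' :: real
  assumes f: "standardized_density f" and \<sigma>: "0 < \<sigma>" "0 < \<sigma>'"
  shows "(W2 (density lborel (loc_scale_density f \<mu> \<sigma>)) (density lborel (loc_scale_density f \<mu>' \<sigma>')))\<^sup>2
    = ennreal ((norm (\<mu>' - \<mu>))\<^sup>2 + CARD('d) * (\<sigma>' - \<sigma>)\<^sup>2)"
proof (rule antisym)
  interpret Z: prob_space "density lborel f" by (rule std_prob_space[OF f])
  note [simp] = std_mean[OF f] std_second_moment[OF f] Z.prob_space[simplified]
  let ?C = "distr (density lborel f) (borel \<Otimes>\<^sub>M borel) (\<lambda>z. (\<mu> + \<sigma> *\<^sub>R z, \<mu>' + \<sigma>' *\<^sub>R z))"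
  have sq: "(norm (\<mu> + \<sigma> *\<^sub>R z - (\<mu>' + \<sigma>' *\<^sub>R z)))\<^sup>2
      = (norm (\<mu>' - \<mu>))\<^sup>2 + 2 * (\<sigma>' - \<sigma>) * (z \<bullet> (\<mu>' - \<mu>)) + (\<sigma>' - \<sigma>)\<^sup>2 * (norm z)\<^sup>2" for z
    unfolding power2_norm_eq_inner
    by (simp add: inner_simps inner_commute power2_eq_square algebra_simps)
  have "?C \<in> couplings (density lborel (loc_scale_density f \<mu> \<sigma>)) (density lborel (loc_scale_density f \<mu>' \<sigma>'))"
    unfolding density_loc_scale[OF f \<sigma>(1)] density_loc_scale[OF f \<sigma>(2)]
    by (rule couplings_distr) (simp_all add: std_prob_space[OF f])
  from W2_square_le[OF this]
  have "(W2 (density lborel (loc_scale_density f \<mu> \<sigma>)) (density lborel (loc_scale_density f \<mu>' \<sigma>')))\<^sup>2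
    \<le> (\<integral>\<^sup>+z. ennreal ((norm (\<mu> + \<sigma> *\<^sub>R z - (\<mu>' + \<sigma>' *\<^sub>R z)))\<^sup>2) \<partial>density lborel f)"
    by (simp add: nn_integral_distr case_prod_beta)
  also have "\<dots> = ennreal (\<integral>z. (norm (\<mu> + \<sigma> *\<^sub>R z - (\<mu>' + \<sigma>' *\<^sub>R z)))\<^sup>2 \<partial>density lborel f)"
    by (rule nn_integral_eq_integral) (simp add: sq, simp)
  also have "(\<integral>z. (norm (\<mu> + \<sigma> *\<^sub>R z - (\<mu>' + \<sigma>' *\<^sub>R z)))\<^sup>2 \<partial>density lborel f)
      = (norm (\<mu>' - \<mu>))\<^sup>2 + CARD('d) * (\<sigma>' - \<sigma>)\<^sup>2"
    by (simp add: sq)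
  finally show "(W2 (density lborel (loc_scale_density f \<mu> \<sigma>)) (density lborel (loc_scale_density f \<mu>' \<sigma>')))\<^sup>2
    \<le> ennreal ((norm (\<mu>' - \<mu>))\<^sup>2 + CARD('d) * (\<sigma>' - \<sigma>)\<^sup>2)" .
next
  show "ennreal ((norm (\<mu>' - \<mu>))\<^sup>2 + CARD('d) * (\<sigma>' - \<sigma>)\<^sup>2)
    \<le> (W2 (density lborel (loc_scale_density f \<mu> \<sigma>)) (density lborel (loc_scale_density f \<mu>' \<sigma>')))\<^sup>2"
  proof (rule W2_square_ge)
    fix C assume C: "C \<in> couplings (density lborel (loc_scale_density f \<mu> \<sigma>)) (density lborel (loc_scale_density f \<mu>' \<sigma>'))"
    \<comment> \<open>The zero test function removes the squared term; what remains is the excess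
      cost at the moments of the second law.\<close>
    from coupling_cost_ge[OF f \<sigma> _ loc_scale_moments(1,3)[OF f \<sigma>(2)] _ _ C, of "\<lambda>_. 0" \<mu>']
    show "ennreal ((norm (\<mu>' - \<mu>))\<^sup>2 + CARD('d) * (\<sigma>' - \<sigma>)\<^sup>2) \<le> (\<integral>\<^sup>+(x, y). ennreal ((norm (x - y))\<^sup>2) \<partial>C)"
      using \<sigma> by (simp add: loc_scale_moments[OF f] excess_cost_plug_in)
  qed
qed

section \<open>Lipschitz test functions determine a distribution\<close>

text \<open>The indicator of a proper open set U is the pointwise limit of min 1 ((k+1) dist(y,
  -U)). Dividing by k+1 restores the Lipschitz constant 1 and does not affect equality of integrals.
  Countably many U suffice, provided that they form a generating system closed under
  intersection.\<close>

lemma determining_lipschitz_functions: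
  obtains \<Phi> :: "('a::euclidean_space \<Rightarrow> real) set"
  where "countable \<Phi>"
    and "\<And>\<phi>. \<phi> \<in> \<Phi> \<Longrightarrow> bounded (range \<phi>)"
    and "\<And>\<phi> x y. \<phi> \<in> \<Phi> \<Longrightarrow> \<bar>\<phi> x - \<phi> y\<bar> \<le> norm (x - y)"
    and "\<And>P Q :: 'a measure. prob_space P \<Longrightarrow> prob_space Q \<Longrightarrow> sets P = sets borel \<Longrightarrow> sets Q = sets borel
      \<Longrightarrow> (\<And>\<phi>. \<phi> \<in> \<Phi> \<Longrightarrow> (\<integral>y. \<phi> y \<partial>P) = (\<integral>y. \<phi> y \<partial>Q)) \<Longrightarrow> P = Q"
proof -
  obtain B :: "'a set set" where B: "countable B" "topological_basis B"
    using ex_countable_basis by blast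
  \<comment> \<open>Finite intersections turn the countable base into a countable
    intersection-stable system; the empty family contributes \<open>UNIV\<close>, which later serves
    as the exhausting sequence.\<close>
  define E where "E = (\<lambda>F. \<Inter>F) ` {F. finite F \<and> F \<subseteq> B}"
  have "countable E"
    unfolding E_def by (intro countable_image countable_Collect_finite_subset B)
  have E_open: "open U" if "U \<in> E" for U
    using that B(2) by (auto simp: E_def intro!: open_Inter dest: topological_basis_open)
  have "B \<subseteq> E"
  proof
    fix U assume "U \<in> B"
    then show "U \<in> E" unfolding E_def by (intro image_eqI[of _ _ "{U}"]) auto
  qed
  then have "topological_basis E"
    using B(2) E_open unfolding topological_basis_def by (meson subset_trans)
  then have borel: "sets (borel :: 'a measure) = sigma_sets UNIV E"
    by (subst borel_eq_countable_basis[OF \<open>countable E\<close>]) simp_all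
  have "Int_stable E"
  proof (rule Int_stableI)
    fix U V assume "U \<in> E" "V \<in> E"
    then obtain F G where "U = \<Inter>F" "finite F" "F \<subseteq> B" "V = \<Inter>G" "finite G" "G \<subseteq> B"
      by (auto simp: E_def)
    then show "U \<inter> V \<in> E"
      unfolding E_def by (intro image_eqI[of _ _ "F \<union> G"]) auto
  qed
  define \<phi> :: "'a set \<Rightarrow> nat \<Rightarrow> 'a \<Rightarrow> real"
    where "\<phi> = (\<lambda>U k y. min (1 / Suc k) (infdist y (- U)))"
  define \<Phi> where "\<Phi> = (\<lambda>(U, k). \<phi> U k) ` (E \<times> UNIV)"
  have range: "0 \<le> \<phi> U k y" "\<phi> U k y \<le> 1 / Suc k" for U k y
    by (auto simp: \<phi>_def infdist_nonneg)
  show ?thesis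
  proof (rule that[of \<Phi>])
    show "countable \<Phi>"
      unfolding \<Phi>_def using \<open>countable E\<close> by (intro countable_image countable_SIGMA) auto
    show "bounded (range \<psi>)" if "\<psi> \<in> \<Phi>" for \<psi>
    proof -
      from that obtain U k where "\<psi> = \<phi> U k" by (auto simp: \<Phi>_def)
      then show ?thesis using range by (auto simp: bounded_iff intro!: exI[of _ "1 / Suc k"])
    qed
    show "\<bar>\<psi> x - \<psi> y\<bar> \<le> norm (x - y)" if "\<psi> \<in> \<Phi>" for \<psi> x y
    proof -
      from that obtain U k where "\<psi> = \<phi> U k" by (auto simp: \<Phi>_def)
      then show ?thesis
        using infdist_triangle_abs[of x "- U" y] by (auto simp: \<phi>_def dist_norm min_def)
    qed
  next
    fix P Q :: "'a measure"
    assume P: "prob_space P" "sets P = sets borel" and Q: "prob_space Q" "sets Q = sets borel"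
      and eq: "\<And>\<psi>. \<psi> \<in> \<Phi> \<Longrightarrow> (\<integral>y. \<psi> y \<partial>P) = (\<integral>y. \<psi> y \<partial>Q)"
    interpret P: prob_space P by fact
    interpret Q: prob_space Q by fact
    have [simp]: "space P = UNIV" "space Q = UNIV"
      using sets_eq_imp_space_eq[OF P(2)] sets_eq_imp_space_eq[OF Q(2)] by simp_all
    have limit: "(\<lambda>k. \<integral>y. Suc k * \<phi> U k y \<partial>M) \<longlonglongrightarrow> measure M U"
      if "prob_space M" "sets M = sets borel" "open U" "U \<noteq> UNIV" for M :: "'a measure" and U
    proof -
      interpret M: prob_space M by fact
      have [simp]: "U \<in> sets M" using \<open>open U\<close> that(2) by simp
      have "\<phi> U k \<in> borel_measurable borel" for k
        unfolding \<phi>_def by (intro borel_measurable_continuous_onI continuous_intros)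
      then have [measurable]: "\<phi> U k \<in> borel_measurable M" for k
        using measurable_cong_sets[OF that(2) refl] by blast
      have "(\<lambda>k. \<integral>y. Suc k * \<phi> U k y \<partial>M) \<longlonglongrightarrow> (\<integral>y. indicator U y \<partial>M)"
      proof (rule integral_dominated_convergence[where w = "\<lambda>_. 1"])
        show "AE y in M. (\<lambda>k. Suc k * \<phi> U k y) \<longlonglongrightarrow> indicator U y"
        proof (rule AE_I2)
          fix y
          show "(\<lambda>k. Suc k * \<phi> U k y) \<longlonglongrightarrow> indicator U y"
          proof (cases "y \<in> U")
            case True
            have "infdist y (- U) \<noteq> 0"
              using True that(3,4) in_closed_iff_infdist_zero[of "- U" y] by auto
            then have pos: "0 < infdist y (- U)"
              using infdist_nonneg[of y "- U"] by linarith
            \<comment> \<open>Once 1 / (k+1) lies below the positive distance, the minimum is 1 /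
              (k+1) and the rescaled function is exactly 1 at y.\<close>
            then have "eventually (\<lambda>k. inverse (real (Suc k)) < infdist y (- U)) sequentially"
              by (intro order_tendstoD(2)[OF LIMSEQ_inverse_real_of_nat])
            then have "eventually (\<lambda>k. Suc k * \<phi> U k y = indicator U y) sequentially"
              by eventually_elim (use True in \<open>auto simp: \<phi>_def min_def field_simps\<close>)
            then show ?thesis by (rule tendsto_eventually)
          next
            case False
            then have "infdist y (- U) = 0" by (intro infdist_zero) auto
            then show ?thesis using False by (simp add: \<phi>_def)
          qed
        qed
        show "AE y in M. norm (Suc k * \<phi> U k y) \<le> 1" for k
          using range[of U k] by (intro AE_I2) (simp add: abs_mult field_simps)
      qed (simp_all add: borel_measurable_indicator)
      then show ?thesis by simp
    qed
    show "P = Q"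
    proof (rule measure_eqI_generator_eq[where E = E and \<Omega> = UNIV and A = "\<lambda>_. UNIV"])
      show "emeasure P U = emeasure Q U" if "U \<in> E" for U
      \<comment> \<open>The distance to an empty complement is 0 by convention, so the test
        functions of \<open>UNIV\<close> vanish and carry no information; total mass settles this
        case.\<close>
      proof (cases "U = UNIV")
        case True
        then show ?thesis using P.emeasure_space_1 Q.emeasure_space_1 by simp
      next
        case False
        have "(\<integral>y. Suc k * \<phi> U k y \<partial>P) = (\<integral>y. Suc k * \<phi> U k y \<partial>Q)" for k
          using eq[of "\<phi> U k"] that by (auto simp: \<Phi>_def)
        then have "measure P U = measure Q U"
          using limit[OF P E_open[OF that] False] limit[OF Q E_open[OF that] False]
          by (intro LIMSEQ_unique[of "\<lambda>k. \<integral>y. Suc k * \<phi> U k y \<partial>P"]) simp_all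
        then show ?thesis by (simp add: P.emeasure_eq_measure Q.emeasure_eq_measure)
      qed
      show "range (\<lambda>_::nat. UNIV) \<subseteq> E"
        unfolding E_def by (auto intro!: image_eqI[of _ _ "{}"])
    qed (use \<open>Int_stable E\<close> borel P Q in auto)
  qed
qed

section \<open>Posterior averaging of the lower bound\<close>

text \<open>As a function of (\<mu>, \<sigma>), the left bound and the right bound have the same
  quadratic part. Their difference is affine and vanishes at (\<mu>', \<sigma>'), the barycentre of
  the weight \<open>w\<close>, so its weighted integral is 0. Here \<open>w\<close> is an
  unnormalized posterior, \<open>g\<close> the squared gap of a test function, and \<open>m\<close>,
  \<open>M\<close> are arbitrary.\<close>

lemma weighted_excess_cost_ge:
  fixes N :: "('a::euclidean_space \<times> real) measure" and w :: "'a \<times> real \<Rightarrow> real"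
  assumes [measurable]: "fst \<in> borel_measurable N" "snd \<in> borel_measurable N"
    and w: "\<And>\<theta>. \<theta> \<in> space N \<Longrightarrow> 0 \<le> w \<theta>"
    and int: "integrable N w" "integrable N (\<lambda>\<theta>. w \<theta> *\<^sub>R fst \<theta>)" "integrable N (\<lambda>\<theta>. w \<theta> * snd \<theta>)"
    and \<mu>': "(\<integral>\<theta>. w \<theta> *\<^sub>R fst \<theta> \<partial>N) = (\<integral>\<theta>. w \<theta> \<partial>N) *\<^sub>R \<mu>'"
    and \<sigma>': "(\<integral>\<theta>. w \<theta> * snd \<theta> \<partial>N) = (\<integral>\<theta>. w \<theta> \<partial>N) * \<sigma>'" "0 < \<sigma>'"
    and g: "0 \<le> g"
  shows "(\<integral>\<^sup>+\<theta>. ennreal ((norm (\<mu>' - fst \<theta>))\<^sup>2 + real d * (\<sigma>' - snd \<theta>)\<^sup>2) * ennreal (w \<theta>) \<partial>N)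
      + ennreal g * ennreal (\<integral>\<theta>. w \<theta> \<partial>N)
    \<le> (\<integral>\<^sup>+\<theta>. ennreal (snd \<theta> / \<sigma>' * g + excess_cost d (fst \<theta>) (snd \<theta>) \<mu>' \<sigma>' m M) * ennreal (w \<theta>) \<partial>N)"
    (is "?lhs \<le> (\<integral>\<^sup>+\<theta>. ennreal (?A \<theta>) * _ \<partial>N)")
proof (cases "(\<integral>\<^sup>+\<theta>. ennreal (?A \<theta>) * ennreal (w \<theta>) \<partial>N) = \<infinity>")
  case False
  let ?B = "\<lambda>\<theta>. (norm (\<mu>' - fst \<theta>))\<^sup>2 + real d * (\<sigma>' - snd \<theta>)\<^sup>2"
  define v where "v = 2 *\<^sub>R (\<mu>' - m)"
  define b where "b = (2 * (m \<bullet> \<mu>') - (norm \<mu>')\<^sup>2 - M + g) / \<sigma>' + d * \<sigma>'"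
  define e where "e = M - (norm \<mu>')\<^sup>2 - d * \<sigma>'\<^sup>2 - g"
  have [measurable]: "w \<in> borel_measurable N" using int(1) by (rule borel_measurable_integrable)
  have A_eq: "?A \<theta> = ?B \<theta> + g + (fst \<theta> \<bullet> v + snd \<theta> * b + e)" for \<theta>
    using \<sigma>'(2) unfolding excess_cost_def v_def b_def e_def power2_norm_eq_inner
    by (simp add: inner_simps inner_commute field_simps power2_eq_square)
  \<comment> \<open>The weight times the affine remainder with coefficients \<open>v\<close>,
    \<open>b\<close>, \<open>e\<close>. Its integral is the total weight times the value of the
    remainder at (\<mu>', \<sigma>').\<close>
  define L where "L = (\<lambda>\<theta>. w \<theta> * (fst \<theta> \<bullet> v) + w \<theta> * snd \<theta> * b + w \<theta> * e)"
  have [simp]: "integrable N (\<lambda>\<theta>. w \<theta> * (fst \<theta> \<bullet> v))"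
      "(\<integral>\<theta>. w \<theta> * (fst \<theta> \<bullet> v) \<partial>N) = (\<integral>\<theta>. w \<theta> \<partial>N) * (\<mu>' \<bullet> v)"
    using integrable_inner_left[of v, OF int(2)] integral_inner_left[of v, OF int(2)] by (simp_all add: \<mu>')
  have int_L: "integrable N L"
    unfolding L_def using int by (intro Bochner_Integration.integrable_add) auto
  have "(\<integral>\<theta>. L \<theta> \<partial>N) = (\<integral>\<theta>. w \<theta> \<partial>N) * (\<mu>' \<bullet> v + \<sigma>' * b + e)"
    unfolding L_def using int by (simp add: \<mu>' \<sigma>') (simp add: algebra_simps)
  also have "\<mu>' \<bullet> v + \<sigma>' * b + e = 0"
    using \<sigma>'(2) unfolding v_def b_def e_def power2_norm_eq_inner
    by (simp add: inner_simps inner_commute field_simps power2_eq_square)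
  finally have L0: "(\<integral>\<theta>. L \<theta> \<partial>N) = 0" by simp
  have wA: "w \<theta> * ?A \<theta> = w \<theta> * ?B \<theta> + w \<theta> * g + L \<theta>" for \<theta>
    unfolding A_eq L_def by (simp add: algebra_simps)
  \<comment> \<open>\<open>ennreal\<close> truncates negative values of the right bound. Truncation
    can only enlarge the right-hand side, which is the favourable direction.\<close>
  have pos_eq: "(\<integral>\<^sup>+\<theta>. ennreal (?A \<theta>) * ennreal (w \<theta>) \<partial>N) = (\<integral>\<^sup>+\<theta>. ennreal (max 0 (w \<theta> * ?A \<theta>)) \<partial>N)"
  proof (rule nn_integral_cong)
    fix \<theta> assume "\<theta> \<in> space N"
    from w[OF this] show "ennreal (?A \<theta>) * ennreal (w \<theta>) = ennreal (max 0 (w \<theta> * ?A \<theta>))"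
      by (cases "0 \<le> ?A \<theta>")
         (auto simp: ennreal_mult[symmetric] mult.commute max_def ennreal_neg mult_nonneg_nonpos
           intro: antisym)
  qed
  have int_pos: "integrable N (\<lambda>\<theta>. max 0 (w \<theta> * ?A \<theta>))"
    using False unfolding pos_eq by (intro integrableI_nonneg) (auto simp: top.not_eq_extremum)
  \<comment> \<open>Posterior second moments are not given but derived: the right-hand side is
    finite in this case, and the weighted plug-in loss is at most its integrand plus |L|.\<close>
  have int_B: "integrable N (\<lambda>\<theta>. w \<theta> * ?B \<theta>)"
  proof (rule Bochner_Integration.integrable_bound)
    show "integrable N (\<lambda>\<theta>. max 0 (w \<theta> * ?A \<theta>) + \<bar>L \<theta>\<bar>)"
      using int_pos int_L by simp
    show "AE \<theta> in N. norm (w \<theta> * ?B \<theta>) \<le> norm (max 0 (w \<theta> * ?A \<theta>) + \<bar>L \<theta>\<bar>)"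
    proof (rule AE_I2)
      fix \<theta> assume "\<theta> \<in> space N"
      from w[OF this] g have "0 \<le> w \<theta> * ?B \<theta>" "0 \<le> w \<theta> * g" by simp_all
      then show "norm (w \<theta> * ?B \<theta>) \<le> norm (max 0 (w \<theta> * ?A \<theta>) + \<bar>L \<theta>\<bar>)"
        using wA[of \<theta>] unfolding real_norm_def by linarith
    qed
  qed measurable
  have "?lhs = ennreal (\<integral>\<theta>. w \<theta> * ?B \<theta> \<partial>N) + ennreal (g * (\<integral>\<theta>. w \<theta> \<partial>N))"
  proof -
    have "(\<integral>\<^sup>+\<theta>. ennreal (?B \<theta>) * ennreal (w \<theta>) \<partial>N) = (\<integral>\<^sup>+\<theta>. ennreal (w \<theta> * ?B \<theta>) \<partial>N)"
      using w by (intro nn_integral_cong) (simp add: ennreal_mult[symmetric] mult.commute del: ennreal_plus)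
    also have "\<dots> = ennreal (\<integral>\<theta>. w \<theta> * ?B \<theta> \<partial>N)"
      using w by (intro nn_integral_eq_integral int_B AE_I2) simp
    finally show ?thesis
      using g w by (simp add: ennreal_mult integral_nonneg_AE)
  qed
  also have "\<dots> = ennreal ((\<integral>\<theta>. w \<theta> * ?B \<theta> \<partial>N) + g * (\<integral>\<theta>. w \<theta> \<partial>N))"
    using g w by (intro ennreal_plus[symmetric] mult_nonneg_nonneg integral_nonneg_AE AE_I2) simp_all
  also have "(\<integral>\<theta>. w \<theta> * ?B \<theta> \<partial>N) + g * (\<integral>\<theta>. w \<theta> \<partial>N) = (\<integral>\<theta>. w \<theta> * ?A \<theta> \<partial>N)"
    unfolding wA using int_B int_L int(1) L0 by simp
  also have "ennreal \<dots> \<le> ennreal (\<integral>\<theta>. max 0 (w \<theta> * ?A \<theta>) \<partial>N)"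
  proof (intro ennreal_leI integral_mono int_pos)
    show "integrable N (\<lambda>\<theta>. w \<theta> * ?A \<theta>)"
      unfolding wA using int_B int_L int(1) by simp
  qed simp
  also have "\<dots> = (\<integral>\<^sup>+\<theta>. ennreal (?A \<theta>) * ennreal (w \<theta>) \<partial>N)"
    unfolding pos_eq by (intro nn_integral_eq_integral[symmetric] int_pos) simp
  finally show ?thesis .
qed simp

section \<open>Posterior means and average risks\<close>

lemma integrable_scaleR_iff:
  fixes h :: "'a \<Rightarrow> 'b::{banach, second_countable_topology}"
  shows "integrable M (\<lambda>x. c *\<^sub>R h x) \<longleftrightarrow> c = 0 \<or> integrable M h"
proof (cases "c = 0")
  case False
  then show ?thesis
    using integrable_scaleR_right[of "inverse c" M "\<lambda>x. c *\<^sub>R h x"] integrable_scaleR_right[of c M h] by auto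
qed simp

lemma space_param_measure: "space param_measure = UNIV \<times> {0<..}"
  by (simp add: param_measure_def space_restrict_space)

lemma param_measurable[measurable]:
  "fst \<in> borel_measurable param_measure" "snd \<in> borel_measurable param_measure"
  by (simp_all add: param_measure_def measurable_restrict_space1 borel_prod[symmetric])

lemma sigma_finite_param_measure: "sigma_finite_measure param_measure"
proof -
  have "UNIV \<times> {0<..} \<in> sets (lborel :: ((real ^ 'd) \<times> real) measure)"
    by (simp add: borel_prod[symmetric])
  then show ?thesis
    unfolding param_measure_def
    by (rule sigma_finite_measure_restrict_space[OF lborel.sigma_finite_measure_axioms])
qed

lemma sigma_finite_sample_space: "sigma_finite_measure (sample_space n)"
proof -
  interpret product_sigma_finite "\<lambda>_. lborel :: (real ^ 'd) measure"
    by unfold_locales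
  show ?thesis
    unfolding sample_space_def by (rule sigma_finite) simp
qed

section \<open>Unnormalized posterior and measurability of the posterior means\<close>

locale loc_scale_bayes =
  fixes f :: "real ^ 'd \<Rightarrow> real" and n :: nat and \<pi> :: "(real ^ 'd) \<times> real \<Rightarrow> real"
  assumes std: "standardized_density f" and prior: "prior_density \<pi>"
begin

abbreviation N where "N \<equiv> param_measure :: ((real ^ 'd) \<times> real) measure"
abbreviation S where "S \<equiv> sample_space n :: (nat \<Rightarrow> real ^ 'd) measure"
abbreviation \<mu>' where "\<mu>' \<equiv> posterior_mean_loc f n \<pi>"
abbreviation \<sigma>' where "\<sigma>' \<equiv> posterior_mean_scale f n \<pi>"
abbreviation p where "p \<mu> \<sigma> \<equiv> density lborel (\<lambda>y. ennreal (loc_scale_density f \<mu> \<sigma> y))"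

text \<open>The posterior before division by the evidence. It is meaningful for every sample, and
  the order of integration over parameters and samples can be exchanged for it directly.\<close>

definition weight :: "(nat \<Rightarrow> real ^ 'd) \<Rightarrow> (real ^ 'd) \<times> real \<Rightarrow> real" where
  "weight x \<theta> = likelihood f n (fst \<theta>) (snd \<theta>) x * \<pi> \<theta>"

sublocale N: sigma_finite_measure N by (rule sigma_finite_param_measure)
sublocale S: sigma_finite_measure S by (rule sigma_finite_sample_space)
sublocale NS: pair_sigma_finite N S ..

lemmas [measurable] = std_measurable[OF std] loc_scale_measurable[OF std]

lemma prior_measurable[measurable]: "\<pi> \<in> borel_measurable N"
  and prior_nonneg: "\<theta> \<in> space N \<Longrightarrow> 0 \<le> \<pi> \<theta>"
  using prior by (auto simp: prior_density_def)

lemma snd_param_pos: "\<theta> \<in> space N \<Longrightarrow> 0 < snd \<theta>"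
  by (auto simp: space_param_measure)

lemma sample_measurable: "i \<in> {1..n} \<Longrightarrow> (\<lambda>x. x i) \<in> borel_measurable S"
  unfolding sample_space_def using measurable_component_singleton[of i "{1..n}" "\<lambda>_. lborel"] by simp

lemma likelihood_measurable[measurable (raw)]:
  assumes [measurable]: "a \<in> borel_measurable M" "b \<in> borel_measurable M" "x \<in> measurable M S"
  shows "(\<lambda>\<omega>. likelihood f n (a \<omega>) (b \<omega>) (x \<omega>)) \<in> borel_measurable M"
proof -
  have [measurable]: "(\<lambda>\<omega>. x \<omega> i) \<in> borel_measurable M" if "i \<in> {1..n}" for i
    using measurable_compose[OF assms(3) sample_measurable[OF that]] .
  show ?thesis
    unfolding likelihood_def loc_scale_density_def by measurable
qed

lemma likelihood_nonneg: "0 < \<sigma> \<Longrightarrow> 0 \<le> likelihood f n \<mu> \<sigma> x"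
  unfolding likelihood_def by (intro prod_nonneg loc_scale_nonneg[OF std] ballI)

lemma weight_measurable[measurable (raw)]:
  assumes [measurable]: "\<theta> \<in> measurable M N" "x \<in> measurable M S"
  shows "(\<lambda>\<omega>. weight (x \<omega>) (\<theta> \<omega>)) \<in> borel_measurable M"
  unfolding weight_def by measurable

lemma weight_nonneg: "\<theta> \<in> space N \<Longrightarrow> 0 \<le> weight x \<theta>"
  unfolding weight_def by (intro mult_nonneg_nonneg likelihood_nonneg prior_nonneg snd_param_pos)

lemma ennreal_weight:
  "\<theta> \<in> space N \<Longrightarrow> ennreal (weight x \<theta>) = ennreal (likelihood f n (fst \<theta>) (snd \<theta>) x) * ennreal (\<pi> \<theta>)"
  unfolding weight_def by (intro ennreal_mult likelihood_nonneg prior_nonneg snd_param_pos)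

lemma evidence_eq: "evidence f n \<pi> x = (\<integral>\<^sup>+\<theta>. ennreal (weight x \<theta>) \<partial>N)"
  by (simp add: evidence_def weight_def case_prod_beta')

lemma evidence_measurable[measurable]: "evidence f n \<pi> \<in> borel_measurable S"
  unfolding evidence_eq[abs_def] by measurable

lemma marginal_likelihood_eq:
  "(\<integral>(\<mu>, \<sigma>). likelihood f n \<mu> \<sigma> x * \<pi> (\<mu>, \<sigma>) \<partial>N) = (\<integral>\<theta>. weight x \<theta> \<partial>N)"
  by (simp add: weight_def case_prod_beta')

lemma posterior_density_eq: "posterior_density f n \<pi> x (fst \<theta>) (snd \<theta>) = weight x \<theta> / (\<integral>\<theta>. weight x \<theta> \<partial>N)"
  by (simp add: posterior_density_def marginal_likelihood_eq) (simp add: weight_def)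

lemma evidence_finite:
  assumes x: "x \<in> space S" and ev: "evidence f n \<pi> x < \<infinity>"
  shows "integrable N (weight x)" "evidence f n \<pi> x = ennreal (\<integral>\<theta>. weight x \<theta> \<partial>N)"
    "0 \<le> (\<integral>\<theta>. weight x \<theta> \<partial>N)"
proof -
  show *: "integrable N (weight x)"
    using ev x weight_nonneg by (intro integrableI_nonneg) (auto simp: evidence_eq intro!: AE_I2)
  show "evidence f n \<pi> x = ennreal (\<integral>\<theta>. weight x \<theta> \<partial>N)"
    unfolding evidence_eq by (intro nn_integral_eq_integral * AE_I2 weight_nonneg)
  show "0 \<le> (\<integral>\<theta>. weight x \<theta> \<partial>N)"
    by (intro integral_nonneg_AE AE_I2 weight_nonneg)
qed

text \<open>Given positive and finite evidence, the normalization is multiplication by a nonzero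
  constant and leaves integrability unchanged.\<close>

lemma posterior_mean_exists_iff:
  assumes x: "x \<in> space S"
  shows "posterior_mean_exists f n \<pi> x \<longleftrightarrow> 0 < evidence f n \<pi> x \<and> evidence f n \<pi> x < \<infinity>
    \<and> integrable N (\<lambda>\<theta>. weight x \<theta> *\<^sub>R fst \<theta>) \<and> integrable N (\<lambda>\<theta>. weight x \<theta> * snd \<theta>)"
proof (cases "0 < evidence f n \<pi> x \<and> evidence f n \<pi> x < \<infinity>")
  case True
  then have Z: "0 < (\<integral>\<theta>. weight x \<theta> \<partial>N)"
    using evidence_finite[OF x] by auto
  have "(\<lambda>\<theta>. (weight x \<theta> / (\<integral>\<theta>. weight x \<theta> \<partial>N)) *\<^sub>R fst \<theta>)
      = (\<lambda>\<theta>. inverse (\<integral>\<theta>. weight x \<theta> \<partial>N) *\<^sub>R (weight x \<theta> *\<^sub>R fst \<theta>))"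
    by (simp add: divide_inverse mult.commute)
  moreover have "(\<lambda>\<theta>. weight x \<theta> / (\<integral>\<theta>. weight x \<theta> \<partial>N) * snd \<theta>)
      = (\<lambda>\<theta>. inverse (\<integral>\<theta>. weight x \<theta> \<partial>N) *\<^sub>R (weight x \<theta> * snd \<theta>))"
    by (simp add: divide_inverse ac_simps)
  ultimately show ?thesis
    using True Z unfolding posterior_mean_exists_def case_prod_beta' posterior_density_eq
    by (simp only: integrable_scaleR_iff) simp
next
  case False
  then show ?thesis by (auto simp: posterior_mean_exists_def)
qed

lemma posterior_mean_loc_eq:
  "posterior_mean_exists f n \<pi> x \<Longrightarrow> \<mu>' x = (\<integral>\<theta>. weight x \<theta> *\<^sub>R fst \<theta> \<partial>N) /\<^sub>R (\<integral>\<theta>. weight x \<theta> \<partial>N)"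
  unfolding posterior_mean_loc_def case_prod_beta' posterior_density_eq divide_inverse
  by (subst integral_scaleR_right[symmetric]) (simp add: mult.commute)

lemma posterior_mean_scale_eq:
  "posterior_mean_exists f n \<pi> x \<Longrightarrow> \<sigma>' x = (\<integral>\<theta>. weight x \<theta> * snd \<theta> \<partial>N) / (\<integral>\<theta>. weight x \<theta> \<partial>N)"
  unfolding posterior_mean_scale_def case_prod_beta' posterior_density_eq
  by simp

text \<open>Integrability is rephrased as finiteness of the integral of the norm, which depends
  measurably on the sample.\<close>

lemma posterior_mean_exists_measurable[measurable]: "Measurable.pred S (posterior_mean_exists f n \<pi>)"
proof -
  have "Measurable.pred S (\<lambda>x. 0 < evidence f n \<pi> x \<and> evidence f n \<pi> x < \<infinity>
      \<and> (\<integral>\<^sup>+\<theta>. ennreal (norm (weight x \<theta> *\<^sub>R fst \<theta>)) \<partial>N) < \<infinity>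
      \<and> (\<integral>\<^sup>+\<theta>. ennreal (norm (weight x \<theta> * snd \<theta>)) \<partial>N) < \<infinity>)"
    by measurable
  also have "?this \<longleftrightarrow> ?thesis"
    by (rule measurable_cong) (simp add: posterior_mean_exists_iff integrable_iff_bounded)
  finally show ?thesis .
qed

lemma posterior_mean_measurable[measurable]:
  "\<mu>' \<in> borel_measurable S" "\<sigma>' \<in> borel_measurable S"
proof -
  have "\<mu>' = (\<lambda>x. if posterior_mean_exists f n \<pi> x
      then (\<integral>\<theta>. weight x \<theta> *\<^sub>R fst \<theta> \<partial>N) /\<^sub>R (\<integral>\<theta>. weight x \<theta> \<partial>N) else 0)"
    using posterior_mean_loc_eq by (intro ext) (simp, simp add: posterior_mean_loc_def)
  then show "\<mu>' \<in> borel_measurable S" by simp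
  have "\<sigma>' = (\<lambda>x. if posterior_mean_exists f n \<pi> x
      then (\<integral>\<theta>. weight x \<theta> * snd \<theta> \<partial>N) / (\<integral>\<theta>. weight x \<theta> \<partial>N) else 1)"
    using posterior_mean_scale_eq by (intro ext) (simp, simp add: posterior_mean_scale_def)
  then show "\<sigma>' \<in> borel_measurable S" by simp
qed

text \<open>Since \<sigma> > 0 on the parameter space, a vanishing weighted mean of \<sigma> would
  force the weight to vanish almost everywhere, against positive evidence. Without a posterior mean
  the default 1 is positive.\<close>

lemma posterior_mean_scale_pos:
  assumes x: "x \<in> space S"
  shows "0 < \<sigma>' x"
proof (cases "posterior_mean_exists f n \<pi> x")
  case True
  then have ev: "0 < evidence f n \<pi> x" "evidence f n \<pi> x < \<infinity>"
    and int: "integrable N (\<lambda>\<theta>. weight x \<theta> * snd \<theta>)"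
    using posterior_mean_exists_iff[OF x] by auto
  have Z: "0 < (\<integral>\<theta>. weight x \<theta> \<partial>N)"
    using evidence_finite[OF x ev(2)] ev by auto
  have nonneg: "0 \<le> weight x \<theta> * snd \<theta>" if "\<theta> \<in> space N" for \<theta>
    using weight_nonneg[OF that, of x] snd_param_pos[OF that] by simp
  have "(\<integral>\<theta>. weight x \<theta> * snd \<theta> \<partial>N) \<noteq> 0"
  proof
    assume "(\<integral>\<theta>. weight x \<theta> * snd \<theta> \<partial>N) = 0"
    then have "AE \<theta> in N. weight x \<theta> * snd \<theta> = 0"
      using integral_nonneg_eq_0_iff_AE[OF int] nonneg by (auto intro: AE_I2)
    then have "AE \<theta> in N. weight x \<theta> = 0"
      by (rule AE_mp) (auto intro!: AE_I2 dest: snd_param_pos)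
    then have "(\<integral>\<theta>. weight x \<theta> \<partial>N) = 0"
      by (rule integral_eq_zero_AE)
    with Z show False by simp
  qed
  moreover have "0 \<le> (\<integral>\<theta>. weight x \<theta> * snd \<theta> \<partial>N)"
    using nonneg by (intro integral_nonneg_AE AE_I2)
  ultimately show ?thesis
    using Z True by (simp add: posterior_mean_scale_eq)
next
  case False
  then show ?thesis by (simp add: posterior_mean_scale_def)
qed

lemma prob_space_loc_scale: "0 < \<sigma> \<Longrightarrow> prob_space (p \<mu> \<sigma>)"
  unfolding density_loc_scale[OF std]
  by (rule prob_space.prob_space_distr[OF std_prob_space[OF std]]) simp

lemma predictive_density_plug_in: "predictive_density n (plug_in_density f n \<pi>)"
  unfolding predictive_density_def
proof (intro conjI ballI allI)
  show "(\<lambda>(x, y). plug_in_density f n \<pi> x y) \<in> borel_measurable (S \<Otimes>\<^sub>M lborel)"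
    unfolding plug_in_density_def loc_scale_density_def by measurable
next
  fix x y assume "x \<in> space S"
  then show "0 \<le> plug_in_density f n \<pi> x y"
    unfolding plug_in_density_def by (intro loc_scale_nonneg[OF std] posterior_mean_scale_pos)
next
  fix x assume "x \<in> space S"
  then interpret prob_space "p (\<mu>' x) (\<sigma>' x)"
    by (intro prob_space_loc_scale posterior_mean_scale_pos)
  show "(\<integral>\<^sup>+y. ennreal (plug_in_density f n \<pi> x y) \<partial>lborel) = 1"
    using emeasure_space_1 by (simp add: emeasure_density plug_in_density_def)
qed

section \<open>Risk and average risk of the plug-in density\<close>

lemma risk_plug_in:
  assumes "0 < \<sigma>"
  shows "risk f n \<mu> \<sigma> (plug_in_density f n \<pi>)
    = (\<integral>\<^sup>+x. ennreal ((norm (\<mu>' x - \<mu>))\<^sup>2 + CARD('d) * (\<sigma>' x - \<sigma>)\<^sup>2)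
        * ennreal (likelihood f n \<mu> \<sigma> x) \<partial>S)"
  unfolding risk_def plug_in_density_def
  by (intro nn_integral_cong) (simp add: W2_loc_scale[OF std assms posterior_mean_scale_pos])

lemma risk_plug_in_split:
  assumes "0 < \<sigma>"
  shows "risk f n \<mu> \<sigma> (plug_in_density f n \<pi>)
    = (\<integral>\<^sup>+x. ennreal ((norm (\<mu>' x - \<mu>))\<^sup>2) \<partial>sample_distr f n \<mu> \<sigma>)
      + of_nat CARD('d) * (\<integral>\<^sup>+x. ennreal ((\<sigma>' x - \<sigma>)\<^sup>2) \<partial>sample_distr f n \<mu> \<sigma>)"
proof -
  have "risk f n \<mu> \<sigma> (plug_in_density f n \<pi>)
    = (\<integral>\<^sup>+x. ennreal ((norm (\<mu>' x - \<mu>))\<^sup>2 + CARD('d) * (\<sigma>' x - \<sigma>)\<^sup>2) \<partial>sample_distr f n \<mu> \<sigma>)"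
    unfolding risk_plug_in[OF assms] sample_distr_def
    by (simp add: nn_integral_density mult.commute)
  also have "\<dots> = (\<integral>\<^sup>+x. ennreal ((norm (\<mu>' x - \<mu>))\<^sup>2) + of_nat CARD('d) * ennreal ((\<sigma>' x - \<sigma>)\<^sup>2)
      \<partial>sample_distr f n \<mu> \<sigma>)"
    by (simp add: ennreal_mult ennreal_of_nat_eq_real_of_nat)
  also have "\<dots> = (\<integral>\<^sup>+x. ennreal ((norm (\<mu>' x - \<mu>))\<^sup>2) \<partial>sample_distr f n \<mu> \<sigma>)
      + of_nat CARD('d) * (\<integral>\<^sup>+x. ennreal ((\<sigma>' x - \<sigma>)\<^sup>2) \<partial>sample_distr f n \<mu> \<sigma>)"
    unfolding sample_distr_def by (subst nn_integral_add) (simp_all add: nn_integral_cmult)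
  finally show ?thesis .
qed

text \<open>Tonelli, with likelihood and prior merged into the weight. The loss \<open>h\<close>
  must be jointly measurable, which holds for the closed form of the plug-in loss and for
  \<open>loss_bound\<close>.\<close>

lemma average_exchange:
  assumes [measurable]: "h \<in> borel_measurable (N \<Otimes>\<^sub>M S)"
  shows "(\<integral>\<^sup>+\<theta>. (\<integral>\<^sup>+x. h (\<theta>, x) * ennreal (likelihood f n (fst \<theta>) (snd \<theta>) x) \<partial>S) * ennreal (\<pi> \<theta>) \<partial>N)
    = (\<integral>\<^sup>+x. (\<integral>\<^sup>+\<theta>. h (\<theta>, x) * ennreal (weight x \<theta>) \<partial>N) \<partial>S)"
proof -
  have "(\<integral>\<^sup>+\<theta>. (\<integral>\<^sup>+x. h (\<theta>, x) * ennreal (likelihood f n (fst \<theta>) (snd \<theta>) x) \<partial>S) * ennreal (\<pi> \<theta>) \<partial>N)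
    = (\<integral>\<^sup>+\<theta>. (\<integral>\<^sup>+x. h (\<theta>, x) * ennreal (weight x \<theta>) \<partial>S) \<partial>N)"
    by (intro nn_integral_cong, subst nn_integral_multc[symmetric])
       (simp_all add: ennreal_weight mult.assoc)
  also have "\<dots> = (\<integral>\<^sup>+x. (\<integral>\<^sup>+\<theta>. h (\<theta>, x) * ennreal (weight x \<theta>) \<partial>N) \<partial>S)"
    by (rule NS.Fubini'[symmetric]) measurable
  finally show ?thesis .
qed

lemma average_risk_plug_in:
  "average_risk f n \<pi> (plug_in_density f n \<pi>)
    = (\<integral>\<^sup>+x. (\<integral>\<^sup>+\<theta>. ennreal ((norm (\<mu>' x - fst \<theta>))\<^sup>2 + CARD('d) * (\<sigma>' x - snd \<theta>)\<^sup>2)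
        * ennreal (weight x \<theta>) \<partial>N) \<partial>S)"
proof -
  have meas: "(\<lambda>(\<theta>, x). ennreal ((norm (\<mu>' x - fst \<theta>))\<^sup>2 + CARD('d) * (\<sigma>' x - snd \<theta>)\<^sup>2))
      \<in> borel_measurable (N \<Otimes>\<^sub>M S)"
    by measurable
  have "average_risk f n \<pi> (plug_in_density f n \<pi>)
    = (\<integral>\<^sup>+\<theta>. (\<integral>\<^sup>+x. (case (\<theta>, x) of (\<theta>, x) \<Rightarrow>
          ennreal ((norm (\<mu>' x - fst \<theta>))\<^sup>2 + CARD('d) * (\<sigma>' x - snd \<theta>)\<^sup>2))
        * ennreal (likelihood f n (fst \<theta>) (snd \<theta>) x) \<partial>S) * ennreal (\<pi> \<theta>) \<partial>N)"
    unfolding average_risk_def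
    by (intro nn_integral_cong) (simp add: case_prod_beta risk_plug_in snd_param_pos del: ennreal_plus)
  also have "\<dots> = (\<integral>\<^sup>+x. (\<integral>\<^sup>+\<theta>. ennreal ((norm (\<mu>' x - fst \<theta>))\<^sup>2 + CARD('d) * (\<sigma>' x - snd \<theta>)\<^sup>2)
        * ennreal (weight x \<theta>) \<partial>N) \<partial>S)"
    unfolding average_exchange[OF meas] by (simp only: prod.case)
  finally show ?thesis .
qed

section \<open>Lower bound for the average risk of an arbitrary predictive density\<close>

definition discrepancy :: "(real ^ 'd \<Rightarrow> real) \<Rightarrow> ((nat \<Rightarrow> real ^ 'd) \<Rightarrow> real ^ 'd \<Rightarrow> real) \<Rightarrow>
    (nat \<Rightarrow> real ^ 'd) \<Rightarrow> real" where
  "discrepancy \<phi> q x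
    = ((\<integral>y. \<phi> y \<partial>p (\<mu>' x) (\<sigma>' x)) - (\<integral>y. \<phi> y \<partial>density lborel (\<lambda>y. ennreal (q x y))))\<^sup>2"

context
  fixes q :: "(nat \<Rightarrow> real ^ 'd) \<Rightarrow> real ^ 'd \<Rightarrow> real"
  assumes q: "predictive_density n q"
begin

lemma predictive_measurable[measurable]: "(\<lambda>(x, y). q x y) \<in> borel_measurable (S \<Otimes>\<^sub>M borel)"
  using q by (simp add: predictive_density_def cong: sets_pair_measure_cong measurable_cong_sets)

lemma predictive_nonneg: "x \<in> space S \<Longrightarrow> 0 \<le> q x y"
  using q by (simp add: predictive_density_def)

lemma predictive_fibre_measurable[measurable]: "x \<in> space S \<Longrightarrow> q x \<in> borel_measurable borel"
  by measurable

lemma predictive_prob_space: "x \<in> space S \<Longrightarrow> prob_space (density lborel (\<lambda>y. ennreal (q x y)))"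
  using q by (intro prob_spaceI) (simp add: emeasure_density predictive_density_def)

definition second_moment :: "(nat \<Rightarrow> real ^ 'd) \<Rightarrow> ennreal" where
  "second_moment x = (\<integral>\<^sup>+y. ennreal (q x y) * ennreal ((norm y)\<^sup>2) \<partial>lborel)"

lemma second_moment_measurable[measurable]: "second_moment \<in> borel_measurable S"
  unfolding second_moment_def[abs_def] by measurable

context
  fixes \<phi> :: "real ^ 'd \<Rightarrow> real"
  assumes \<phi>: "\<And>x y. \<bar>\<phi> x - \<phi> y\<bar> \<le> norm (x - y)" "bounded (range \<phi>)"
begin

lemma lipschitz_measurable[measurable]: "\<phi> \<in> borel_measurable borel"
  using \<phi>(1) by (intro borel_measurable_continuous_onI lipschitz_on_continuous_on[of 1] lipschitz_onI)
    (auto simp: dist_norm)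

text \<open>Both expectations become Lebesgue integrals whose integrands are jointly measurable in
  sample and observation.\<close>

lemma discrepancy_measurable[measurable]: "discrepancy \<phi> q \<in> borel_measurable S"
proof -
  have "(\<lambda>x. ((\<integral>y. loc_scale_density f (\<mu>' x) (\<sigma>' x) y * \<phi> y \<partial>lborel)
      - (\<integral>y. q x y * \<phi> y \<partial>lborel))\<^sup>2) \<in> borel_measurable S"
    unfolding loc_scale_density_def by measurable
  also have "?this \<longleftrightarrow> ?thesis"
    by (rule measurable_cong)
       (simp add: discrepancy_def integral_density predictive_nonneg loc_scale_nonneg[OF std]
          posterior_mean_scale_pos)
  finally show ?thesis .
qed

text \<open>A measurable minorant of the squared distance between the true law and the prediction.
  The value is infinite when the prediction lacks a second moment, because every coupling then has
  infinite cost; otherwise it is the bound of \<open>coupling_cost_ge\<close>.\<close>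

definition loss_bound :: "(real ^ 'd) \<times> real \<Rightarrow> (nat \<Rightarrow> real ^ 'd) \<Rightarrow> ennreal" where
  "loss_bound \<theta> x = (if second_moment x = \<infinity> then \<infinity> else
     ennreal (snd \<theta> / \<sigma>' x * discrepancy \<phi> q x
       + excess_cost CARD('d) (fst \<theta>) (snd \<theta>) (\<mu>' x) (\<sigma>' x) (\<integral>y. q x y *\<^sub>R y \<partial>lborel) (enn2real (second_moment x))))"

lemma loss_bound_measurable[measurable]: "(\<lambda>(\<theta>, x). loss_bound \<theta> x) \<in> borel_measurable (N \<Otimes>\<^sub>M S)"
  unfolding loss_bound_def by measurable

lemma W2_ge_loss_bound:
  assumes \<theta>: "\<theta> \<in> space N" and x: "x \<in> space S"
  shows "loss_bound \<theta> x \<le> (W2 (p (fst \<theta>) (snd \<theta>)) (density lborel (\<lambda>y. ennreal (q x y))))\<^sup>2"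
proof (rule W2_square_ge)
  let ?Q = "density lborel (\<lambda>y. ennreal (q x y))"
  note [measurable] = predictive_fibre_measurable[OF x]
  interpret Q: prob_space ?Q by (rule predictive_prob_space[OF x])
  fix C assume C: "C \<in> couplings (p (fst \<theta>) (snd \<theta>)) ?Q"
  have M: "(\<integral>\<^sup>+y. ennreal ((norm y)\<^sup>2) \<partial>?Q) = second_moment x"
    by (simp add: second_moment_def nn_integral_density)
  show "loss_bound \<theta> x \<le> (\<integral>\<^sup>+(x, y). ennreal ((norm (x - y))\<^sup>2) \<partial>C)"
  proof (cases "second_moment x = \<infinity>")
    case True
    then show ?thesis
      using coupling_cost_infinite[OF std snd_param_pos[OF \<theta>] _ _ C] M by simp
  next
    case False
    have sq: "integrable ?Q (\<lambda>y. (norm y)\<^sup>2)"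
      using False M by (intro integrableI_nonneg) (auto simp: top.not_eq_extremum)
    then have "integrable ?Q (\<lambda>y. norm y)"
      by (rule Q.square_integrable_imp_integrable[rotated]) simp
    then have "integrable ?Q (\<lambda>y. y)"
      by (subst (asm) integrable_norm_iff) simp_all
    \<comment> \<open>Any comparison parameters with positive scale would give a valid bound; the
      posterior means are the ones for which the affine remainder averages to zero.\<close>
    note cost = coupling_cost_ge[OF std snd_param_pos[OF \<theta>] posterior_mean_scale_pos[OF x] _ this sq \<phi> C, of "\<mu>' x"]
    have "(\<integral>y. (norm y)\<^sup>2 \<partial>?Q) = enn2real (second_moment x)"
      by (subst integral_eq_nn_integral) (simp_all add: M)
    moreover have "(\<integral>y. y \<partial>?Q) = (\<integral>y. q x y *\<^sub>R y \<partial>lborel)"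
      using predictive_nonneg[OF x] by (simp add: integral_density)
    ultimately show ?thesis
      using cost False by (simp add: loss_bound_def discrepancy_def)
  qed
qed

text \<open>The comparison is made sample by sample, after integrating over the parameters; for a
  fixed parameter the plug-in density need not be the better one.\<close>

lemma average_risk_ge:
  assumes post: "AE x in prior_predictive f n \<pi>. posterior_mean_exists f n \<pi> x"
  shows "average_risk f n \<pi> (plug_in_density f n \<pi>)
      + (\<integral>\<^sup>+x. ennreal (discrepancy \<phi> q x) * evidence f n \<pi> x \<partial>S) \<le> average_risk f n \<pi> q"
proof -
  let ?B = "\<lambda>x \<theta>. ennreal ((norm (\<mu>' x - fst \<theta>))\<^sup>2 + CARD('d) * (\<sigma>' x - snd \<theta>)\<^sup>2)"
  have "AE x in S. 0 < evidence f n \<pi> x \<longrightarrow> posterior_mean_exists f n \<pi> x"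
    using post unfolding prior_predictive_def by (simp add: AE_density)
  then have fibre: "AE x in S. (\<integral>\<^sup>+\<theta>. ?B x \<theta> * ennreal (weight x \<theta>) \<partial>N)
      + ennreal (discrepancy \<phi> q x) * evidence f n \<pi> x
      \<le> (\<integral>\<^sup>+\<theta>. loss_bound \<theta> x * ennreal (weight x \<theta>) \<partial>N)"
  proof (rule AE_mp, intro AE_I2 impI)
    fix x assume x: "x \<in> space S" and "0 < evidence f n \<pi> x \<longrightarrow> posterior_mean_exists f n \<pi> x"
    then consider "evidence f n \<pi> x = 0" | "posterior_mean_exists f n \<pi> x"
      by (auto simp: zero_less_iff_neq_zero)
    then show "(\<integral>\<^sup>+\<theta>. ?B x \<theta> * ennreal (weight x \<theta>) \<partial>N) + ennreal (discrepancy \<phi> q x) * evidence f n \<pi> x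
      \<le> (\<integral>\<^sup>+\<theta>. loss_bound \<theta> x * ennreal (weight x \<theta>) \<partial>N)"
    proof cases
      \<comment> \<open>With zero evidence the weight vanishes almost everywhere, so the default
        estimates used at such samples contribute nothing.\<close>
      case 1
      then have "AE \<theta> in N. ennreal (weight x \<theta>) = 0"
        using x by (simp add: evidence_eq nn_integral_0_iff_AE)
      then have "(\<integral>\<^sup>+\<theta>. ?B x \<theta> * ennreal (weight x \<theta>) \<partial>N) = (\<integral>\<^sup>+\<theta>. 0 \<partial>N)"
        by (intro nn_integral_cong_AE) auto
      with 1 show ?thesis by simp
    next
      case 2
      then have ev: "0 < evidence f n \<pi> x" "evidence f n \<pi> x < \<infinity>"
        and int: "integrable N (\<lambda>\<theta>. weight x \<theta> *\<^sub>R fst \<theta>)" "integrable N (\<lambda>\<theta>. weight x \<theta> * snd \<theta>)"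
        using posterior_mean_exists_iff[OF x] by auto
      note Z = evidence_finite[OF x ev(2)]
      have Z0: "(\<integral>\<theta>. weight x \<theta> \<partial>N) \<noteq> 0" using Z ev by auto
      show ?thesis
      proof (cases "second_moment x = \<infinity>")
        case True
        then have "(\<integral>\<^sup>+\<theta>. loss_bound \<theta> x * ennreal (weight x \<theta>) \<partial>N) = \<infinity> * evidence f n \<pi> x"
          using x by (simp add: loss_bound_def evidence_eq nn_integral_cmult)
        also have "\<dots> = \<infinity>" using ev by (simp add: ennreal_top_mult)
        finally show ?thesis by simp
      next
        case False
        show ?thesis
          unfolding loss_bound_def Z(2) if_not_P[OF False]
          by (rule weighted_excess_cost_ge[OF _ _ weight_nonneg Z(1) int _ _ posterior_mean_scale_pos[OF x]])
             (use Z0 2 in \<open>simp_all add: posterior_mean_loc_eq posterior_mean_scale_eq discrepancy_def\<close>)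
      qed
    qed
  qed
  have "average_risk f n \<pi> (plug_in_density f n \<pi>)
      + (\<integral>\<^sup>+x. ennreal (discrepancy \<phi> q x) * evidence f n \<pi> x \<partial>S)
    = (\<integral>\<^sup>+x. (\<integral>\<^sup>+\<theta>. ?B x \<theta> * ennreal (weight x \<theta>) \<partial>N) + ennreal (discrepancy \<phi> q x) * evidence f n \<pi> x \<partial>S)"
    unfolding average_risk_plug_in by (rule nn_integral_add[symmetric]) measurable
  also have "\<dots> \<le> (\<integral>\<^sup>+x. (\<integral>\<^sup>+\<theta>. loss_bound \<theta> x * ennreal (weight x \<theta>) \<partial>N) \<partial>S)"
    by (rule nn_integral_mono_AE[OF fibre])
  also have "\<dots> = (\<integral>\<^sup>+\<theta>. (\<integral>\<^sup>+x. loss_bound \<theta> x * ennreal (likelihood f n (fst \<theta>) (snd \<theta>) x) \<partial>S)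
      * ennreal (\<pi> \<theta>) \<partial>N)"
    using average_exchange[OF loss_bound_measurable] by simp
  \<comment> \<open>The distance to \<open>q\<close> enters only after the exchange of integrals, by
    monotonicity, which holds for arbitrary integrands.\<close>
  also have "\<dots> \<le> average_risk f n \<pi> q"
    unfolding average_risk_def risk_def case_prod_beta'
    by (intro nn_integral_mono) (auto intro!: mult_right_mono nn_integral_mono W2_ge_loss_bound)
  finally show ?thesis .
qed

end

end

section \<open>Optimality and uniqueness\<close>

lemma bayes_predictive_density_plug_in:
  assumes post: "AE x in prior_predictive f n \<pi>. posterior_mean_exists f n \<pi> x"
  shows "bayes_predictive_density f n \<pi> (plug_in_density f n \<pi>)"
  unfolding bayes_predictive_density_def
proof (intro conjI allI impI predictive_density_plug_in)
  fix q :: "(nat \<Rightarrow> real ^ 'd) \<Rightarrow> real ^ 'd \<Rightarrow> real" assume "predictive_density n q"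
  from average_risk_ge[OF this _ _ post, of "\<lambda>_. 0"]
  show "average_risk f n \<pi> (plug_in_density f n \<pi>) \<le> average_risk f n \<pi> q"
    by (auto intro: order_trans[rotated])
qed

lemma bayes_predictive_density_unique:
  assumes post: "AE x in prior_predictive f n \<pi>. posterior_mean_exists f n \<pi> x"
    and q: "bayes_predictive_density f n \<pi> q" and fin: "average_risk f n \<pi> q < \<infinity>"
  shows "AE x in prior_predictive f n \<pi>. AE y in lborel. q x y = plug_in_density f n \<pi> x y"
proof (rule determining_lipschitz_functions)
  fix \<Phi> :: "(real ^ 'd \<Rightarrow> real) set"
  assume \<Phi>: "countable \<Phi>" "\<And>\<phi>. \<phi> \<in> \<Phi> \<Longrightarrow> bounded (range \<phi>)"
      "\<And>\<phi> x y. \<phi> \<in> \<Phi> \<Longrightarrow> \<bar>\<phi> x - \<phi> y\<bar> \<le> norm (x - y)"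
    and determined: "\<And>P Q :: (real ^ 'd) measure. prob_space P \<Longrightarrow> prob_space Q
      \<Longrightarrow> sets P = sets borel \<Longrightarrow> sets Q = sets borel
      \<Longrightarrow> (\<And>\<phi>. \<phi> \<in> \<Phi> \<Longrightarrow> (\<integral>y. \<phi> y \<partial>P) = (\<integral>y. \<phi> y \<partial>Q)) \<Longrightarrow> P = Q"
  have pred: "predictive_density n q"
    and le: "average_risk f n \<pi> q \<le> average_risk f n \<pi> (plug_in_density f n \<pi>)"
    using q predictive_density_plug_in by (auto simp: bayes_predictive_density_def)
  have "AE x in prior_predictive f n \<pi>. discrepancy \<phi> q x = 0" if "\<phi> \<in> \<Phi>" for \<phi>
  proof -
    note [measurable] = discrepancy_measurable[OF pred \<Phi>(3,2)[OF that]]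
    let ?r = "average_risk f n \<pi> (plug_in_density f n \<pi>)"
    let ?D = "\<integral>\<^sup>+x. ennreal (discrepancy \<phi> q x) * evidence f n \<pi> x \<partial>S"
    have "?r + ?D \<le> ?r"
      using average_risk_ge[OF pred \<Phi>(3,2)[OF that] post] le by (rule order_trans)
    moreover have "?r \<le> ?r + ?D" by simp
    then have "?r < \<infinity>"
      using average_risk_ge[OF pred \<Phi>(3,2)[OF that] post] fin by (meson le_less_trans)
    \<comment> \<open>The plug-in average risk is finite because it is bounded by that of
      \<open>q\<close>, so it cancels.\<close>
    ultimately have "?D = 0"
      using ennreal_add_left_cancel_le[of ?r ?D 0] by auto
    then have "(\<integral>\<^sup>+x. ennreal (discrepancy \<phi> q x) \<partial>prior_predictive f n \<pi>) = 0"
      unfolding prior_predictive_def by (simp add: nn_integral_density mult.commute)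
    then have "AE x in prior_predictive f n \<pi>. ennreal (discrepancy \<phi> q x) = 0"
      by (subst (asm) nn_integral_0_iff_AE) (simp_all add: prior_predictive_def)
    then show ?thesis
      by eventually_elim (simp add: discrepancy_def)
  qed
  \<comment> \<open>Countability of \<Phi> merges the exceptional null sets into one, so that at
    almost every sample all test functions agree at once and the two laws coincide.\<close>
  then have "AE x in prior_predictive f n \<pi>. \<forall>\<phi>\<in>\<Phi>. discrepancy \<phi> q x = 0"
    using \<Phi>(1) by (simp add: AE_ball_countable)
  then show ?thesis
  proof (rule AE_mp)
    show "AE x in prior_predictive f n \<pi>. (\<forall>\<phi>\<in>\<Phi>. discrepancy \<phi> q x = 0)
        \<longrightarrow> (AE y in lborel. q x y = plug_in_density f n \<pi> x y)"
    proof (rule AE_I2, rule impI)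
      fix x assume "x \<in> space (prior_predictive f n \<pi>)" and 0: "\<forall>\<phi>\<in>\<Phi>. discrepancy \<phi> q x = 0"
      then have x: "x \<in> space S" by (simp add: prior_predictive_def)
      note [measurable] = predictive_fibre_measurable[OF pred x]
      have "density lborel (\<lambda>y. ennreal (q x y)) = p (\<mu>' x) (\<sigma>' x)"
        using 0 by (intro determined predictive_prob_space[OF pred x] prob_space_loc_scale
            posterior_mean_scale_pos[OF x]) (auto simp: discrepancy_def)
      then have "AE y in lborel. ennreal (q x y) = ennreal (loc_scale_density f (\<mu>' x) (\<sigma>' x) y)"
        by (subst (asm) sigma_finite_measure.density_unique_iff[OF lborel.sigma_finite_measure_axioms]) simp_all
      then show "AE y in lborel. q x y = plug_in_density f n \<pi> x y"
        by eventually_elim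
           (simp add: plug_in_density_def predictive_nonneg[OF pred x]
              loc_scale_nonneg[OF std posterior_mean_scale_pos[OF x]])
    qed
  qed
qed

end

theorem theorem4p2:
  fixes f :: "real ^ 'd \<Rightarrow> real"
    and \<pi> :: "(real ^ 'd) \<times> real \<Rightarrow> real"
    and n :: nat
  assumes f: "standardized_density f"
    and n: "1 \<le> n"
    and prior: "prior_density \<pi>"
    and post: "AE x in prior_predictive f n \<pi>. posterior_mean_exists f n \<pi> x"
  shows "bayes_predictive_density f n \<pi> (plug_in_density f n \<pi>)
    \<and> (\<forall>q. bayes_predictive_density f n \<pi> q \<and> average_risk f n \<pi> q < \<infinity> \<longrightarrow>
          (AE x in prior_predictive f n \<pi>. AE y in lborel. q x y = plug_in_density f n \<pi> x y))
    \<and> (\<forall>x\<in>space (sample_space n). posterior_mean_exists f n \<pi> x \<longrightarrow>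
          posterior_mean_loc f n \<pi> x =
            (\<integral>(\<mu>, \<sigma>). (likelihood f n \<mu> \<sigma> x * \<pi> (\<mu>, \<sigma>)) *\<^sub>R \<mu> \<partial>param_measure) /\<^sub>R
            (\<integral>(\<mu>, \<sigma>). likelihood f n \<mu> \<sigma> x * \<pi> (\<mu>, \<sigma>) \<partial>param_measure)
        \<and> posterior_mean_scale f n \<pi> x =
            (\<integral>(\<mu>, \<sigma>). \<sigma> * (likelihood f n \<mu> \<sigma> x * \<pi> (\<mu>, \<sigma>)) \<partial>param_measure) /
            (\<integral>(\<mu>, \<sigma>). likelihood f n \<mu> \<sigma> x * \<pi> (\<mu>, \<sigma>) \<partial>param_measure))
    \<and> (\<forall>\<mu> \<sigma>. 0 < \<sigma> \<longrightarrow>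
          risk f n \<mu> \<sigma> (plug_in_density f n \<pi>) =
            (\<integral>\<^sup>+x. ennreal ((norm (posterior_mean_loc f n \<pi> x - \<mu>))\<^sup>2) \<partial>sample_distr f n \<mu> \<sigma>)
          + of_nat CARD('d) *
            (\<integral>\<^sup>+x. ennreal ((posterior_mean_scale f n \<pi> x - \<sigma>)\<^sup>2) \<partial>sample_distr f n \<mu> \<sigma>))"
proof -
  interpret loc_scale_bayes f n \<pi>
    using f prior by unfold_locales
  show ?thesis
    using bayes_predictive_density_plug_in[OF post] bayes_predictive_density_unique[OF post]
      posterior_mean_loc_eq posterior_mean_scale_eq risk_plug_in_split
    by (auto simp: marginal_likelihood_eq weight_def case_prod_beta' mult.commute)
qed

end
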